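(* Let $m\le n$ be natural numbers ($m\ge 1$). Then, for any $r>0$, $$\mu_{\mathbb{S}^n}\big(\mathbb{S}^n\setminus(\mathbb{S}^{n-m})_r\big)\le \min\left\{A_m\,e^{-\frac{1}{3\pi}\sqrt{2n/m}\,r},\ \widetilde{A}_m\,e^{-\frac{1}{3\pi}\sqrt{n/(2m)}\,r},\ B_m\,e^{-\frac{n-1}{4\pi^2m}r^2},\ \widetilde{B}_m\,e^{-\frac{n-1}{8\pi^2m}r^2}\right\},$$ where $$A_m=1+\frac{\sqrt{\pi}\,e^{\frac{9m-3}{4m-2}}}{2}\left\{2+e^{\frac{1}{4m-2}}\right\},\qquad \widetilde{A}_m=1+\frac{\sqrt{\pi}\,e^{\frac{m+1}{4m-2}}}{2}\left\{2+e^{\frac{1}{4m-2}}\right\},$$ $$B_m=1+\sqrt{\pi}\,e^{\pi^2+\frac{m+1}{4m-2}},\qquad \widetilde{B}_m=1+\sqrt{\pi}\,e^{\frac{m+1}{4m-2}}.$$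
   Context: $\mathbb{S}^n$ is the $n$-dimensional standard unit sphere in $\mathbb{R}^{n+1}$ centered at zero, with its Riemannian (geodesic) distance and its Riemannian volume measure $\mu_{\mathbb{S}^n}$ normalized to be a probability measure. For $k\le n$, $\mathbb{S}^k$ is regarded as a subset of $\mathbb{S}^n$ in the natural way; thus $\mathbb{S}^{n-m}$ is the set of points $(x_1,\dots,x_{n+1})\in\mathbb{S}^n$ with $x_1=\cdots=x_m=0$ (up to rotation). For a subset $A\subset\mathbb{S}^n$, $A_r$ denotes its open $r$-neighbourhood. *)

theory Defs
  imports "HOL-Analysis.Analysis"
begin

section \<open>Riemannian distance and volume of subsets of Euclidean space\<close>

definition riemannian_dist :: "'b::real_normed_vector set \<Rightarrow> 'b \<Rightarrow> 'b \<Rightarrow> real" where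
  "riemannian_dist S x y =
     Inf {integral {0..1} (\<lambda>t. norm (vector_derivative \<gamma> (at t))) | \<gamma>.
            valid_path \<gamma> \<and> path_image \<gamma> \<subseteq> S \<and> pathstart \<gamma> = x \<and> pathfinish \<gamma> = y}"

definition open_nbhd :: "'b::real_normed_vector set \<Rightarrow> 'b set \<Rightarrow> real \<Rightarrow> 'b set" where
  "open_nbhd S A r = {x \<in> S. \<exists>a\<in>A. riemannian_dist S x a < r}"

text \<open>Inverses of charts of \<open>S\<close> as a submanifold of the Euclidean space: \<open>C\<^sup>1\<close> immersions of
  open sets that are homeomorphisms onto relatively open subsets of \<open>S\<close>.\<close>

definition local_parametrization ::
    "(real^'k \<Rightarrow> 'b::euclidean_space) \<Rightarrow> (real^'k) set \<Rightarrow> 'b set \<Rightarrow> bool" where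
  "local_parametrization \<phi> U S \<longleftrightarrow>
     open U \<and> openin (top_of_set S) (\<phi> ` U) \<and> (\<exists>\<psi>. homeomorphism U (\<phi> ` U) \<phi> \<psi>) \<and>
     (\<forall>y\<in>U. \<phi> differentiable (at y) \<and> inj (frechet_derivative \<phi> (at y))) \<and>
     (\<forall>v. continuous_on U (\<lambda>y. frechet_derivative \<phi> (at y) v))"

text \<open>The matrix of the metric induced by the Euclidean inner product, in the coordinates given by
  \<open>\<phi>\<close>.\<close>

definition gram_matrix :: "(real^'k \<Rightarrow> 'b::euclidean_space) \<Rightarrow> real^'k \<Rightarrow> real^'k^'k" where
  "gram_matrix \<phi> y =
     (\<chi> i j. frechet_derivative \<phi> (at y) (axis i 1) \<bullet> frechet_derivative \<phi> (at y) (axis j 1))"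

definition volume_density :: "(real^'k \<Rightarrow> 'b::euclidean_space) \<Rightarrow> real^'k \<Rightarrow> real" where
  "volume_density \<phi> y = sqrt (det (gram_matrix \<phi> y))"

text \<open>The Borel measure on \<open>S\<close> given in all local coordinates by \<open>sqrt (det g) dy\<close>. The
  dimension of \<open>S\<close> is the cardinality of the index type of the coordinate space, which is passed as
  a type argument.\<close>

definition is_riemannian_volume ::
    "'k::finite itself \<Rightarrow> 'b::euclidean_space set \<Rightarrow> 'b measure \<Rightarrow> bool" where
  "is_riemannian_volume _ S M \<longleftrightarrow>
     sets M = sets (restrict_space borel S) \<and>
     (\<forall>(\<phi> :: real^'k \<Rightarrow> 'b) U E. local_parametrization \<phi> U S \<longrightarrow> E \<in> sets borel \<longrightarrow> E \<subseteq> U \<longrightarrow>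
        emeasure M (\<phi> ` E) = (\<integral>\<^sup>+y\<in>E. ennreal (volume_density \<phi> y) \<partial>lborel))"

definition riemannian_volume ::
    "'k::finite itself \<Rightarrow> 'b::euclidean_space set \<Rightarrow> 'b measure" where
  "riemannian_volume K S = (THE M. is_riemannian_volume K S M)"

definition normalized_riemannian_volume ::
    "'k::finite itself \<Rightarrow> 'b::euclidean_space set \<Rightarrow> 'b measure" where
  "normalized_riemannian_volume K S =
     scale_measure (inverse (emeasure (riemannian_volume K S) S)) (riemannian_volume K S)"


section \<open>Existence and uniqueness of the volume of the sphere\<close>

text \<open>The definite description in the definition of the volume is justified for the unit sphere by
  theorem \<open>is_riemannian_volume_sphere\<close> below. The class constraint \<open>wellorder\<close> on the index type
  of the coordinates stems from the library's change of variables theorem; every positive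
  cardinality is attained by a type of this class.\<close>

lemma ennreal_eq_if_finite_iff:
  fixes X Y :: ennreal
  assumes "\<And>r. r \<ge> 0 \<Longrightarrow> X = ennreal r \<longleftrightarrow> Y = ennreal r"
  shows "X = Y"
proof (cases X rule: ennreal_cases)
  case (real r)
  then show ?thesis using assms[of r] by simp
next
  case top
  then show ?thesis
  proof (cases Y rule: ennreal_cases)
    case (real r)
    then show ?thesis using assms[of r] by simp
  qed simp
qed

lemma nn_integral_change_of_variables:
  fixes g :: "real^'m::{finite,wellorder} \<Rightarrow> real^'m::_" and f :: "real^'m::_ \<Rightarrow> real"
  assumes S: "S \<in> sets borel" and gS: "g ` S \<in> sets borel"
    and der: "\<And>x. x \<in> S \<Longrightarrow> (g has_derivative g' x) (at x within S)"
    and inj: "inj_on g S"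
    and f: "f \<in> borel_measurable borel" "\<And>x. f x \<ge> 0"
    and h: "(\<lambda>x. indicator S x * h x) \<in> borel_measurable borel"
    and hf: "\<And>x. x \<in> S \<Longrightarrow> h x = \<bar>det (matrix (g' x))\<bar> * f (g x)"
  shows "(\<integral>\<^sup>+x\<in>g ` S. ennreal (f x) \<partial>lborel) = (\<integral>\<^sup>+x\<in>S. ennreal (h x) \<partial>lborel)"
proof -
  have key: "((\<lambda>x. indicator A x * u x) has_integral r) UNIV \<longleftrightarrow>
      (\<integral>\<^sup>+x\<in>A. ennreal (u x) \<partial>lborel) = ennreal r"
    if "(\<lambda>x. indicator A x * u x) \<in> borel_measurable borel" "\<And>x. x \<in> A \<Longrightarrow> u x \<ge> 0" "r \<ge> 0"
    for A :: "(real^'m::_) set" and u :: "real^'m::_ \<Rightarrow> real" and r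
  proof -
    have nn: "0 \<le> indicator A x * u x" for x
      using that(2) by (simp add: indicator_def)
    have "(\<lambda>x. indicator A x * u x) \<in> lebesgue \<rightarrow>\<^sub>M borel"
      using that(1) by (simp add: measurable_completion)
    moreover have "integral\<^sup>N lebesgue (\<lambda>x. ennreal (indicator A x * u x)) =
        (\<integral>\<^sup>+x\<in>A. ennreal (u x) \<partial>lborel)"
      by (subst nn_integral_completion) (auto intro!: nn_integral_cong simp: indicator_def)
    ultimately show ?thesis
      using has_integral_iff_nn_integral_lebesgue[of "\<lambda>x. indicator A x * u x" r, OF nn] that(3) by simp
  qed
  have abs: "((\<lambda>x. indicator A x * u x) has_integral r) UNIV \<longleftrightarrow>
      ((\<lambda>x. vec (u x) :: real^1) absolutely_integrable_on A \<and> integral A (\<lambda>x. vec (u x) :: real^1) = vec r)"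
    if "\<And>x. x \<in> A \<Longrightarrow> u x \<ge> 0" for A :: "(real^'m::_) set" and u :: "real^'m::_ \<Rightarrow> real" and r
  proof -
    have "((\<lambda>x. indicator A x * u x) has_integral r) UNIV \<longleftrightarrow> (u has_integral r) A"
      unfolding has_integral_restrict_UNIV[of A u, symmetric]
      by (intro arg_cong[where f="\<lambda>z. (z has_integral r) UNIV"]) (auto simp: indicator_def)
    also have "\<dots> \<longleftrightarrow> u integrable_on A \<and> integral A u = r"
      by (metis has_integral_iff)
    also have "\<dots> \<longleftrightarrow> u absolutely_integrable_on A \<and> integral A u = r"
      using absolutely_integrable_on_iff_nonneg[of A u] that by auto
    finally show ?thesis
      by (auto simp: absolutely_integrable_on_1_iff integral_on_1_eq vec_eq_iff)
  qed
  have hnn: "\<And>x. x \<in> S \<Longrightarrow> h x \<ge> 0"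
    using hf f(2) by simp
  have Sl: "S \<in> sets lebesgue"
    using S by auto
  have fm: "(\<lambda>x. indicator (g ` S) x * f x) \<in> borel_measurable borel"
    using f(1) gS by measurable
  show ?thesis
  proof (rule ennreal_eq_if_finite_iff)
    fix r :: real assume r: "r \<ge> 0"
    have "(\<integral>\<^sup>+x\<in>g ` S. ennreal (f x) \<partial>lborel) = ennreal r \<longleftrightarrow>
        (\<lambda>x. vec (f x) :: real^1) absolutely_integrable_on (g ` S) \<and>
        integral (g ` S) (\<lambda>x. vec (f x) :: real^1) = vec r"
      using key[OF fm f(2) r] abs[of "g ` S" f r] f(2) by simp
    also have "\<dots> \<longleftrightarrow> (\<lambda>x. \<bar>det (matrix (g' x))\<bar> *\<^sub>R (vec (f (g x)) :: real^1)) absolutely_integrable_on S \<and>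
        integral S (\<lambda>x. \<bar>det (matrix (g' x))\<bar> *\<^sub>R (vec (f (g x)) :: real^1)) = vec r"
      by (rule has_absolute_integral_change_of_variables[OF Sl der inj, symmetric])
    also have "\<dots> \<longleftrightarrow> (\<lambda>x. vec (h x) :: real^1) absolutely_integrable_on S \<and>
        integral S (\<lambda>x. vec (h x) :: real^1) = vec r"
    proof -
      have eq: "\<bar>det (matrix (g' x))\<bar> *\<^sub>R (vec (f (g x)) :: real^1) = vec (h x)" if "x \<in> S" for x
        using hf[OF that] by (simp add: vec_eq_iff)
      have "(\<lambda>x. \<bar>det (matrix (g' x))\<bar> *\<^sub>R (vec (f (g x)) :: real^1)) absolutely_integrable_on S \<longleftrightarrow>
          (\<lambda>x. vec (h x) :: real^1) absolutely_integrable_on S"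
        by (rule set_integrable_cong) (use eq in auto)
      moreover have "integral S (\<lambda>x. \<bar>det (matrix (g' x))\<bar> *\<^sub>R (vec (f (g x)) :: real^1)) =
          integral S (\<lambda>x. vec (h x) :: real^1)"
        by (rule integral_cong) (use eq in auto)
      ultimately show ?thesis by simp
    qed
    also have "\<dots> \<longleftrightarrow> (\<integral>\<^sup>+x\<in>S. ennreal (h x) \<partial>lborel) = ennreal r"
      using key[OF h hnn r] abs[of S h r] hnn by simp
    finally show "(\<integral>\<^sup>+x\<in>g ` S. ennreal (f x) \<partial>lborel) = ennreal r \<longleftrightarrow>
        (\<integral>\<^sup>+x\<in>S. ennreal (h x) \<partial>lborel) = ennreal r" .
  qed
qed

lemma volume_density_nonneg:
  fixes s :: "real^'k \<Rightarrow> 'b::euclidean_space"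
  assumes "s differentiable (at y)"
  shows "volume_density s y \<ge> 0"
proof (rule ccontr)
  let ?D = "frechet_derivative s (at y)" and ?G = "gram_matrix s y"
  assume "\<not> ?thesis"
  then have neg: "det ?G < 0"
    by (simp add: volume_density_def)
  have linD: "linear ?D"
    using assms frechet_derivative_works has_derivative_linear by blast
  have pd: "v \<bullet> (?G *v v) \<ge> 0" for v
  proof -
    have "?D v = ?D (\<Sum>a\<in>UNIV. v $ a *\<^sub>R axis a 1)"
      using basis_expansion[of v] by (simp add: scalar_mult_eq_scaleR)
    also have "\<dots> = (\<Sum>a\<in>UNIV. v $ a *\<^sub>R ?D (axis a 1))"
      using linD by (simp add: linear_sum linear_scale)
    finally have D: "?D v = (\<Sum>a\<in>UNIV. v $ a *\<^sub>R ?D (axis a 1))" .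
    have "?D v \<bullet> ?D v = v \<bullet> (?G *v v)"
      unfolding D inner_vec_def matrix_vector_mult_def gram_matrix_def
      by (simp add: inner_sum_left inner_sum_right sum_distrib_left mult_ac inner_commute)
    then show ?thesis by (metis inner_ge_zero)
  qed
  define P where "P = (\<lambda>l::real. (1 - l) *\<^sub>R ?G + l *\<^sub>R mat 1)"
  define p where "p = (\<lambda>l. det (P l))"
  have "continuous_on {0..1} p"
    unfolding p_def P_def det_def by (simp, intro continuous_intros)
  moreover have "p 0 < 0" "p 1 = 1"
    using neg by (simp_all add: p_def P_def)
  ultimately obtain l where l: "0 \<le> l" "l \<le> 1" "p l = 0"
    using IVT'[of p 0 0 1] by auto
  have "l > 0" using l \<open>p 0 < 0\<close> by (cases "l = 0") auto
  have "\<not> invertible (P l)"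
    using l(3) by (simp add: p_def invertible_det_nz)
  then obtain v where v: "v \<noteq> 0" "P l *v v = 0"
    by (metis invertible_left_inverse matrix_left_invertible_ker)
  have "0 = v \<bullet> (P l *v v)"
    by (simp add: v)
  also have "\<dots> = (1 - l) * (v \<bullet> (?G *v v)) + l * (v \<bullet> v)"
    unfolding P_def
    by (simp add: matrix_vector_mult_add_rdistrib scaleR_matrix_vector_assoc[symmetric]
        inner_add_right)
  also have "\<dots> > 0"
    using pd[of v] v(1) l \<open>l > 0\<close>
    by (intro add_nonneg_pos mult_nonneg_nonneg mult_pos_pos) auto
  finally show False by simp
qed

lemma gram_matrix_compose:
  fixes \<sigma> :: "real^'k \<Rightarrow> 'b::euclidean_space" and h :: "real^'k \<Rightarrow> real^'k"
  assumes h: "h differentiable (at y)" and s: "\<sigma> differentiable (at (h y))"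
    and ev: "open V" "y \<in> V" "\<And>z. z \<in> V \<Longrightarrow> \<phi> z = \<sigma> (h z)"
  shows "gram_matrix \<phi> y = transpose (matrix (frechet_derivative h (at y))) **
           gram_matrix \<sigma> (h y) ** matrix (frechet_derivative h (at y))"
proof -
  let ?H = "frechet_derivative h (at y)" and ?D = "frechet_derivative \<sigma> (at (h y))"
  have Dh: "(h has_derivative ?H) (at y)" and Ds: "(\<sigma> has_derivative ?D) (at (h y))"
    using h s frechet_derivative_works by blast+
  have "((\<sigma> \<circ> h) has_derivative (?D \<circ> ?H)) (at y)"
    by (rule diff_chain_at[OF Dh Ds])
  then have "(\<phi> has_derivative (?D \<circ> ?H)) (at y)"
    by (rule has_derivative_transform_within_open[OF _ ev(1,2)]) (use ev(3) in auto)
  then have F: "frechet_derivative \<phi> (at y) = ?D \<circ> ?H"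
    using frechet_derivative_at by metis
  have lin: "linear ?D" using Ds has_derivative_linear by blast
  have col: "?D (?H (axis i 1)) = (\<Sum>a\<in>UNIV. matrix ?H $ a $ i *\<^sub>R ?D (axis a 1))" for i
  proof -
    have "?H (axis i 1) = (\<Sum>a\<in>UNIV. (?H (axis i 1)) $ a *\<^sub>R axis a 1)"
      using basis_expansion[of "?H (axis i 1)"] by (simp add: scalar_mult_eq_scaleR)
    then have "?D (?H (axis i 1)) = ?D (\<Sum>a\<in>UNIV. (?H (axis i 1)) $ a *\<^sub>R axis a 1)"
      by simp
    also have "\<dots> = (\<Sum>a\<in>UNIV. (?H (axis i 1)) $ a *\<^sub>R ?D (axis a 1))"
      using lin by (simp add: linear_sum linear_scale)
    finally show ?thesis by (simp add: matrix_def)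
  qed
  show ?thesis
    by (simp add: vec_eq_iff gram_matrix_def F col matrix_matrix_mult_def transpose_def
        inner_sum_left inner_sum_right sum_distrib_left sum_distrib_right)
       (intro allI sum.cong refl, simp add: mult_ac inner_commute)
qed

lemma volume_density_compose:
  fixes \<sigma> :: "real^'k \<Rightarrow> 'b::euclidean_space" and h :: "real^'k \<Rightarrow> real^'k"
  assumes "h differentiable (at y)" "\<sigma> differentiable (at (h y))"
    "open V" "y \<in> V" "\<And>z. z \<in> V \<Longrightarrow> \<phi> z = \<sigma> (h z)"
  shows "volume_density \<phi> y =
    \<bar>det (matrix (frechet_derivative h (at y)))\<bar> * volume_density \<sigma> (h y)"
proof -
  have "det (gram_matrix \<phi> y) =
      (det (matrix (frechet_derivative h (at y))))\<^sup>2 * det (gram_matrix \<sigma> (h y))"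
    using arg_cong[OF gram_matrix_compose[OF assms], of det]
    by (simp add: det_mul det_transpose power2_eq_square mult_ac)
  then show ?thesis
    by (simp add: volume_density_def real_sqrt_mult)
qed

lemma continuous_on_volume_density:
  fixes \<phi> :: "real^'k \<Rightarrow> 'b::euclidean_space"
  assumes "local_parametrization \<phi> U S"
  shows "continuous_on U (volume_density \<phi>)"
proof -
  have c: "continuous_on U (\<lambda>y. frechet_derivative \<phi> (at y) v)" for v
    using assms by (simp add: local_parametrization_def)
  show ?thesis
    unfolding volume_density_def det_def gram_matrix_def
    by (simp, intro continuous_intros c)
qed


definition stereo :: "(real^'k) \<times> real \<Rightarrow> real^'k" where
  "stereo p = fst p /\<^sub>R (1 - snd p)"

definition inv_stereo :: "real^'k \<Rightarrow> (real^'k) \<times> real" where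
  "inv_stereo y = ((2 / (1 + y \<bullet> y)) *\<^sub>R y, (y \<bullet> y - 1) / (1 + y \<bullet> y))"

lemma inv_stereo_pos: "1 + y \<bullet> y > 0" for y :: "real^'k"
  by (simp add: add_pos_nonneg)

lemma stereo_inv_stereo: "stereo (inv_stereo y) = y"
proof -
  have p: "1 + y \<bullet> y > 0" by (rule inv_stereo_pos)
  have "1 - (y \<bullet> y - 1) / (1 + y \<bullet> y) = 2 / (1 + y \<bullet> y)"
    using p by (simp add: field_simps)
  moreover have "inverse (2 / (1 + y \<bullet> y)) * (2 / (1 + y \<bullet> y)) = 1"
    using p by (intro left_inverse) simp
  ultimately show ?thesis
    by (simp add: stereo_def inv_stereo_def del: inverse_divide times_divide_eq_right)
qed

lemma norm_inv_stereo: "norm (inv_stereo y) = 1"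
proof -
  have p: "1 + y \<bullet> y > 0" by (rule inv_stereo_pos)
  have "inv_stereo y \<bullet> inv_stereo y = (4 * (y \<bullet> y) + (y \<bullet> y - 1)^2) / (1 + y \<bullet> y)^2"
    by (simp add: inv_stereo_def inner_prod_def power2_eq_square add_divide_distrib)
  also have "4 * (y \<bullet> y) + (y \<bullet> y - 1)^2 = (1 + y \<bullet> y)^2"
    by (simp add: power2_eq_square algebra_simps)
  finally show ?thesis using p by (simp add: norm_eq_sqrt_inner)
qed

lemma snd_inv_stereo_less: "snd (inv_stereo y) < 1"
  using inv_stereo_pos[of y] by (simp add: inv_stereo_def)

lemma inv_stereo_stereo:
  assumes "norm p = 1" "snd p \<noteq> 1"
  shows "inv_stereo (stereo p) = p"
proof -
  obtain u t where p: "p = (u, t)" by (cases p)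
  have 1: "u \<bullet> u + t * t = 1" using assms(1) by (simp add: p norm_eq_1 inner_prod_def)
  have t: "t < 1"
  proof -
    have "t * t \<le> 1" using 1 inner_ge_zero[of u] by linarith
    then have "t \<le> 1" by (metis abs_le_square_iff abs_le_D1 abs_one one_power2 power2_eq_square)
    then show ?thesis using assms(2) p by simp
  qed
  define s where "s = stereo p"
  have s: "s = u /\<^sub>R (1 - t)" by (simp add: s_def p stereo_def)
  have ss: "s \<bullet> s = (1 + t) / (1 - t)"
  proof -
    have "s \<bullet> s = (u \<bullet> u) / ((1 - t) * (1 - t))" by (simp add: s divide_inverse)
    also have "u \<bullet> u = (1 + t) * (1 - t)" using 1 by (simp add: algebra_simps)
    finally show ?thesis using t by simp
  qed
  have a: "1 + s \<bullet> s = 2 / (1 - t)" "s \<bullet> s - 1 = 2 * t / (1 - t)"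
    using t by (simp_all add: ss field_simps)
  have "(2 / (2 / (1 - t))) *\<^sub>R s = u"
  proof -
    have "2 / (2 / (1 - t)) = 1 - t" using t by simp
    then show ?thesis using t by (simp add: s del: divide_divide_eq_right)
  qed
  moreover have "2 * t / (1 - t) / (2 / (1 - t)) = t" using t by simp
  ultimately show ?thesis
    unfolding s_def[symmetric] inv_stereo_def a by (simp add: p del: divide_divide_eq_right)
qed

lemma differentiable_stereo: "snd p \<noteq> 1 \<Longrightarrow> stereo differentiable (at p)"
  unfolding stereo_def differentiable_def
  by (rule exI) (rule derivative_eq_intros refl | simp)+

lemma continuous_on_stereo: "continuous_on {p. snd p \<noteq> 1} stereo"
  unfolding stereo_def by (intro continuous_intros) auto

lemma inv_stereo_has_derivative:
  fixes y :: "real^'a"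
  shows "(inv_stereo has_derivative (\<lambda>h.
      ((2 / (1 + y \<bullet> y)) *\<^sub>R h - (4 * (y \<bullet> h) / (1 + y \<bullet> y)^2) *\<^sub>R y,
       4 * (y \<bullet> h) / (1 + y \<bullet> y)^2))) (at y)"
proof -
  have p: "1 + y \<bullet> y \<noteq> 0" for y :: "real^'a" using inv_stereo_pos[of y] by simp
  have eq: "inv_stereo = (\<lambda>y :: real^'a. ((2 / (1 + y \<bullet> y)) *\<^sub>R y, 1 - 2 / (1 + y \<bullet> y)))"
    using p by (auto simp: inv_stereo_def fun_eq_iff field_simps)
  show ?thesis
    unfolding eq
    by (rule has_derivative_Pair; (rule derivative_eq_intros refl p)+;
        simp add: fun_eq_iff inner_commute power2_eq_square divide_inverse)
qed

lemma local_parametrization_stereo: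
  fixes L :: "(real^'k) \<times> real \<Rightarrow> 'b::euclidean_space"
  assumes L: "linear L" "linear L'" "\<And>x. norm (L x) = norm x" "\<And>x. norm (L' x) = norm x"
    "\<And>x. L' (L x) = x" "\<And>x. L (L' x) = x"
  shows "local_parametrization (L \<circ> inv_stereo) UNIV (sphere 0 1)"
    and "range (L \<circ> inv_stereo) = sphere 0 1 - {L (0, 1)}"
    and "homeomorphism UNIV (sphere 0 1 - {L (0, 1)}) (L \<circ> inv_stereo) (stereo \<circ> L')"
proof -
  let ?s = "L \<circ> inv_stereo" and ?t = "stereo \<circ> L'" and ?N = "L (0, 1)"
  have bl: "bounded_linear L" "bounded_linear L'"
    using L(1,2) by (simp_all add: linear_conv_bounded_linear)
  have snd1: "snd (L' x) \<noteq> 1" if "x \<in> sphere 0 1 - {?N}" for x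
  proof
    assume a: "snd (L' x) = 1"
    obtain u where u: "L' x = (u, 1)" using a by (cases "L' x") auto
    have "norm (L' x) = 1" using that L(4) by simp
    then have "u \<bullet> u = 0" by (simp add: u norm_eq_1 inner_prod_def)
    then have "L' x = (0, 1)" by (simp add: u)
    then have "x = ?N" using L(6)[of x] by simp
    then show False using that by simp
  qed
  have ts: "?t (?s y) = y" for y by (simp add: L(5) stereo_inv_stereo)
  have st: "?s (?t x) = x" if "x \<in> sphere 0 1 - {?N}" for x
    using that snd1[OF that] L(4)[of x] by (simp add: inv_stereo_stereo L(6))
  have in_S: "?s y \<in> sphere 0 1 - {?N}" for y
  proof -
    have "inv_stereo y \<noteq> (0, 1)" using snd_inv_stereo_less[of y] by auto
    then have "?s y \<noteq> ?N" by (metis L(5) comp_apply)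
    then show ?thesis by (simp add: L(3) norm_inv_stereo)
  qed
  show rng: "range ?s = sphere 0 1 - {?N}"
    using in_S st by (metis (no_types, lifting) image_subset_iff rangeI subsetI subset_antisym)
  have Ds: "(?s has_derivative (\<lambda>h. L
      ((2 / (1 + y \<bullet> y)) *\<^sub>R h - (4 * (y \<bullet> h) / (1 + y \<bullet> y)^2) *\<^sub>R y,
       4 * (y \<bullet> h) / (1 + y \<bullet> y)^2))) (at y)" for y
    unfolding comp_def by (rule bounded_linear.has_derivative[OF bl(1) inv_stereo_has_derivative])
  have diff: "?s differentiable (at y)" for y
    using Ds differentiable_def by blast
  have fd: "frechet_derivative ?s (at y) = (\<lambda>h. L
      ((2 / (1 + y \<bullet> y)) *\<^sub>R h - (4 * (y \<bullet> h) / (1 + y \<bullet> y)^2) *\<^sub>R y,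
       4 * (y \<bullet> h) / (1 + y \<bullet> y)^2))" for y
    using frechet_derivative_at[OF Ds] by simp
  have contd: "continuous_on UNIV (\<lambda>y. frechet_derivative ?s (at y) v)" for v
    unfolding fd
    by (intro bounded_linear.continuous_on[OF bl(1)] continuous_intros)
       (use inv_stereo_pos in \<open>metis less_irrefl power_eq_0_iff\<close>)+
  have injd: "inj (frechet_derivative ?s (at y))" for y
  proof -
    have "snd (L' (?s y)) \<noteq> 1" using snd1[OF in_S] .
    then have "stereo differentiable (at (L' (?s y)))" by (rule differentiable_stereo)
    moreover have "L' differentiable (at (?s y))"
      using bl(2) bounded_linear_imp_differentiable by blast
    ultimately have "?t differentiable (at (?s y))"
      by (intro differentiable_chain_at)
    then obtain T where T: "(?t has_derivative T) (at (?s y))"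
      using differentiable_def by blast
    have "(?s has_derivative frechet_derivative ?s (at y)) (at y)"
      using diff frechet_derivative_works by blast
    from diff_chain_at[OF this T]
    have "(id has_derivative (T \<circ> frechet_derivative ?s (at y))) (at y)"
      using ts by (simp add: comp_def id_def)
    then have "T \<circ> frechet_derivative ?s (at y) = id"
      using has_derivative_id has_derivative_unique by blast
    then show ?thesis by (metis inj_on_id inj_on_imageI2)
  qed
  show hom: "homeomorphism UNIV (sphere 0 1 - {?N}) ?s ?t"
  proof (rule homeomorphismI)
    show "continuous_on UNIV ?s"
      using diff by (intro continuous_at_imp_continuous_on ballI differentiable_imp_continuous_within)
    show "continuous_on (sphere 0 1 - {?N}) ?t"
    proof (rule continuous_on_compose)
      show "continuous_on (sphere 0 1 - {?N}) L'"
        using bl(2) linear_continuous_on by blast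
      show "continuous_on (L' ` (sphere 0 1 - {?N})) stereo"
        by (rule continuous_on_subset[OF continuous_on_stereo]) (use snd1 in auto)
    qed
  qed (use in_S st ts in \<open>auto simp del: comp_apply\<close>)
  show "local_parametrization ?s UNIV (sphere 0 1)"
    unfolding local_parametrization_def
  proof (intro conjI ballI allI)
    show "openin (top_of_set (sphere 0 1)) (range ?s)"
      unfolding rng by (rule openin_delete) simp
    show "\<exists>\<psi>. homeomorphism UNIV (range ?s) ?s \<psi>"
      using hom rng by auto
  qed (use diff injd contd in auto)
qed

text \<open>The pushforward of the coordinate volume under one stereographic parametrization gives the
  right values in every other local parametrization, the one missing point being null.\<close>

lemma is_riemannian_volume_sphere_exists:
  fixes L :: "(real^'k::{finite,wellorder}) \<times> real \<Rightarrow> 'b::euclidean_space"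
  assumes L: "linear L" "linear L'" "\<And>x. norm (L x) = norm x" "\<And>x. norm (L' x) = norm x"
    "\<And>x. L' (L x) = x" "\<And>x. L (L' x) = x"
  shows "is_riemannian_volume TYPE('k) (sphere 0 1)
    (distr (density lborel (\<lambda>y. ennreal (volume_density (L \<circ> inv_stereo) y)))
       (restrict_space borel (sphere 0 1)) (L \<circ> inv_stereo))"
proof -
  define s where "s = L \<circ> inv_stereo"
  define t where "t = stereo \<circ> L'"
  define N where "N = L (0, 1)"
  let ?S = "sphere 0 1 :: 'b set"
  let ?V = "distr (density lborel (\<lambda>y. ennreal (volume_density s y))) (restrict_space borel ?S) s"
  have lp: "local_parametrization s UNIV ?S" and rng: "range s = ?S - {N}"
    and hom: "homeomorphism UNIV (?S - {N}) s t"
    using local_parametrization_stereo[OF L] by (simp_all add: s_def t_def N_def)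
  have cs: "continuous_on UNIV s" and ts: "\<And>y. t (s y) = y" and st: "\<And>x. x \<in> ?S - {N} \<Longrightarrow> s (t x) = x"
    using hom by (auto simp: homeomorphism_def)
  have sB: "s \<in> borel \<rightarrow>\<^sub>M borel"
    using cs by (rule borel_measurable_continuous_onI)
  have sM: "s \<in> borel \<rightarrow>\<^sub>M restrict_space borel ?S"
    by (rule measurable_restrict_space2) (use rng sB in auto)
  have vdB: "volume_density s \<in> borel \<rightarrow>\<^sub>M borel"
    using continuous_on_volume_density[OF lp] by (rule borel_measurable_continuous_onI)
  have ds: "s differentiable (at y)" for y
    using lp by (simp add: local_parametrization_def)
  have dt: "t differentiable (at x)" if "x \<in> ?S - {N}" for x
  proof -
    have "x \<in> range s" using that unfolding rng .
    then obtain y where x: "x = s y" by (rule rangeE)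
    have "snd (L' x) \<noteq> 1"
      using snd_inv_stereo_less[of y] by (simp add: x s_def L(5))
    then have "stereo differentiable (at (L' x))" by (rule differentiable_stereo)
    moreover have "L' differentiable (at x)"
      using L(2) bounded_linear_imp_differentiable linear_conv_bounded_linear by blast
    ultimately show ?thesis unfolding t_def by (intro differentiable_chain_at)
  qed
  have vd_nonneg: "volume_density s y \<ge> 0" for y
    by (rule volume_density_nonneg[OF ds])
  have "is_riemannian_volume TYPE('k) ?S ?V"
    unfolding is_riemannian_volume_def
  proof (intro conjI allI impI)
    show "sets ?V = sets (restrict_space borel ?S)" by simp
  next
    fix \<phi> :: "real^'k::_ \<Rightarrow> 'b" and U E
    assume \<phi>: "local_parametrization \<phi> U ?S" and E: "E \<in> sets borel" "E \<subseteq> U"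
    obtain \<psi> where oU: "open U" and o: "openin (top_of_set ?S) (\<phi> ` U)"
      and h\<phi>: "homeomorphism U (\<phi> ` U) \<phi> \<psi>"
      and d\<phi>: "\<And>y. y \<in> U \<Longrightarrow> \<phi> differentiable (at y)"
      using \<phi> unfolding local_parametrization_def by blast
    have c\<phi>: "continuous_on U \<phi>" and c\<psi>: "continuous_on (\<phi> ` U) \<psi>"
      and \<psi>\<phi>: "\<And>y. y \<in> U \<Longrightarrow> \<psi> (\<phi> y) = y"
      using h\<phi> by (auto simp: homeomorphism_def)
    have \<phi>US: "\<phi> ` U \<subseteq> ?S" using o openin_imp_subset by blast
    have \<phi>UB: "\<phi> ` U \<in> sets borel"
    proof -
      obtain T where "open T" "\<phi> ` U = ?S \<inter> T" using o openin_open by metis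
      then show ?thesis by auto
    qed
    have im_B: "\<phi> ` F \<in> sets borel" if "F \<in> sets borel" "F \<subseteq> U" for F
    proof -
      have "\<psi> \<in> restrict_space borel (\<phi> ` U) \<rightarrow>\<^sub>M borel"
        using c\<psi> by (rule borel_measurable_continuous_on_restrict)
      then have "\<psi> -` F \<inter> space (restrict_space borel (\<phi> ` U)) \<in> sets (restrict_space borel (\<phi> ` U))"
        using that(1) by (rule measurable_sets)
      moreover have "\<psi> -` F \<inter> space (restrict_space borel (\<phi> ` U)) = \<phi> ` F"
        using that(2) \<psi>\<phi> by (auto simp: space_restrict_space)
      ultimately show ?thesis
        using \<phi>UB by (simp add: sets_restrict_space_iff)
    qed
    define U' where "U' = {y \<in> U. \<phi> y \<noteq> N}"
    have oU': "open U'"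
    proof -
      have "open (U \<inter> \<phi> -` (- {N}))"
        using c\<phi> oU by (intro continuous_open_preimage) auto
      then show ?thesis by (simp add: U'_def vimage_def Int_def)
    qed
    define E' where "E' = E \<inter> U'"
    have E': "E' \<in> sets borel" "E' \<subseteq> U'" "E' \<subseteq> U"
      using E oU' by (auto simp: E'_def U'_def)
    define h where "h = t \<circ> \<phi>"
    have U'S: "\<phi> y \<in> ?S - {N}" if "y \<in> U'" for y
      using that \<phi>US by (auto simp: U'_def)
    have sh: "s (h y) = \<phi> y" if "y \<in> U'" for y
      using st[OF U'S[OF that]] by (simp add: h_def)
    have dh: "h differentiable (at y)" if "y \<in> U'" for y
      unfolding h_def using d\<phi>[of y] dt[OF U'S[OF that]] that
      by (intro differentiable_chain_at) (auto simp: U'_def)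
    have inj: "inj_on h U'"
    proof (rule inj_onI)
      fix a b assume "a \<in> U'" "b \<in> U'" "h a = h b"
      then have "\<phi> a = \<phi> b" using sh by metis
      then show "a = b" using \<open>a \<in> U'\<close> \<open>b \<in> U'\<close> \<psi>\<phi> by (metis (no_types, lifting) U'_def mem_Collect_eq)
    qed
    have hE: "h ` E' = s -` (\<phi> ` E)"
    proof
      show "h ` E' \<subseteq> s -` (\<phi> ` E)" using sh E'(2) by (auto simp: E'_def)
      show "s -` (\<phi> ` E) \<subseteq> h ` E'"
      proof
        fix y assume "y \<in> s -` (\<phi> ` E)"
        then obtain e where e: "e \<in> E" "s y = \<phi> e" by auto
        have "\<phi> e \<noteq> N" using e(2) rng by (metis DiffD2 insertCI rangeI)
        then have "e \<in> E'" using e E by (auto simp: E'_def U'_def)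
        moreover have "h e = y" using e(2) ts by (metis comp_apply h_def)
        ultimately show "y \<in> h ` E'" by auto
      qed
    qed
    have \<phi>EB: "\<phi> ` E \<in> sets borel" using im_B E by blast
    have hEB: "h ` E' \<in> sets borel"
      unfolding hE using measurable_sets[OF sB \<phi>EB] by simp
    have vd\<phi>: "volume_density \<phi> y =
        \<bar>det (matrix (frechet_derivative h (at y)))\<bar> * volume_density s (h y)" if "y \<in> U'" for y
      by (rule volume_density_compose[OF dh[OF that] ds oU' that]) (simp add: sh)
    have vdm: "(\<lambda>y. indicator F y * volume_density \<phi> y) \<in> borel_measurable borel"
      if "F \<in> sets borel" "F \<subseteq> U" for F
    proof -
      have "volume_density \<phi> \<in> borel_measurable (restrict_space borel U)"
        using continuous_on_volume_density[OF \<phi>] by (rule borel_measurable_continuous_on_restrict)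
      then have m: "(\<lambda>y. indicator U y *\<^sub>R volume_density \<phi> y) \<in> borel_measurable borel"
        using oU by (subst (asm) borel_measurable_restrict_space_iff) auto
      have "(\<lambda>y. indicator F y * (indicator U y *\<^sub>R volume_density \<phi> y)) \<in> borel_measurable borel"
        using m that(1) by measurable
      also have "(\<lambda>y. indicator F y * (indicator U y *\<^sub>R volume_density \<phi> y)) =
          (\<lambda>y. indicator F y * volume_density \<phi> y)"
        using that(2) by (auto simp: fun_eq_iff indicator_def)
      finally show ?thesis .
    qed
    have "emeasure ?V (\<phi> ` E) =
        emeasure (density lborel (\<lambda>y. ennreal (volume_density s y))) (s -` (\<phi> ` E))"
    proof (subst emeasure_distr)
      show "\<phi> ` E \<in> sets (restrict_space borel ?S)"
        using \<phi>EB E \<phi>US by (auto simp: sets_restrict_space_iff)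
    qed (use sM in auto)
    also have "\<dots> = (\<integral>\<^sup>+y\<in>h ` E'. ennreal (volume_density s y) \<partial>lborel)"
      unfolding hE[symmetric] using hEB vdB by (subst emeasure_density) auto
    also have "\<dots> = (\<integral>\<^sup>+y\<in>E'. ennreal (volume_density \<phi> y) \<partial>lborel)"
    proof (rule nn_integral_change_of_variables[where g' = "\<lambda>y. frechet_derivative h (at y)"])
      show "(h has_derivative frechet_derivative h (at y)) (at y within E')" if "y \<in> E'" for y
        using dh[of y] that E' frechet_derivative_works has_derivative_at_withinI by blast
      show "volume_density \<phi> y = \<bar>det (matrix (frechet_derivative h (at y)))\<bar> * volume_density s (h y)"
        if "y \<in> E'" for y
        using vd\<phi> E'(2) that by blast
      show "(\<lambda>y. indicator E' y * volume_density \<phi> y) \<in> borel_measurable borel"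
        using vdm E' by blast
      show "inj_on h E'"
        using inj E'(2) by (rule inj_on_subset)
    qed (fact E' hEB vdB vd_nonneg)+
    also have "\<dots> = (\<integral>\<^sup>+y\<in>E. ennreal (volume_density \<phi> y) \<partial>lborel)"
    proof (rule nn_integral_cong_AE)
      have "AE y in lborel. y \<noteq> \<psi> N"
        by (rule AE_lborel_singleton)
      then show "AE y in lborel. ennreal (volume_density \<phi> y) * indicator E' y =
          ennreal (volume_density \<phi> y) * indicator E y"
        by eventually_elim
           (use E(2) \<psi>\<phi> in \<open>auto simp: E'_def U'_def indicator_def\<close>)
    qed
    finally show "emeasure ?V (\<phi> ` E) = (\<integral>\<^sup>+y\<in>E. ennreal (volume_density \<phi> y) \<partial>lborel)" .
  qed
  then show ?thesis by (simp add: s_def)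
qed

lemma is_riemannian_volume_sphere_unique:
  fixes M1 M2 :: "'b::euclidean_space measure"
  assumes dim: "DIM('b) = CARD('k::finite) + 1"
    and M1: "is_riemannian_volume TYPE('k) (sphere 0 1) M1"
    and M2: "is_riemannian_volume TYPE('k) (sphere 0 1) M2"
  shows "M1 = M2"
proof -
  let ?S = "sphere 0 1 :: 'b set"
  have "DIM((real^'k) \<times> real) = DIM('b)" using dim by simp
  then obtain L :: "(real^'k) \<times> real \<Rightarrow> 'b" and L' where
    L: "linear L" "linear L'" "\<And>x. norm (L x) = norm x" "\<And>x. norm (L' x) = norm x"
       "\<And>x. L' (L x) = x" "\<And>x. L (L' x) = x"
    by (rule isomorphisms_UNIV_UNIV) (rule that)
  have K: "linear (\<lambda>x. - L x)" "linear (\<lambda>x. - L' x)" "\<And>x. norm (- L x) = norm x"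
    "\<And>x. norm (- L' x) = norm x" "\<And>x. - L' (- L x) = x" "\<And>x. - L (- L' x) = x"
    using L linear_neg[OF L(1)] linear_neg[OF L(2)]
    by (simp_all add: linear_compose_neg)
  define s where "s = L \<circ> inv_stereo"
  define s2 where "s2 = (\<lambda>x. - L x) \<circ> inv_stereo"
  define N where "N = L (0, 1)"
  have lp: "local_parametrization s UNIV ?S" and rng: "range s = ?S - {N}"
    using local_parametrization_stereo[OF L] by (simp_all add: s_def N_def)
  have lp2: "local_parametrization s2 UNIV ?S"
    using local_parametrization_stereo(1)[OF K] by (simp add: s2_def)
  have s20: "s2 0 = N"
    using linear_neg[OF L(1), of "(0, 1)"] linear_neg[OF L(1), of "(0, -1)"]
    by (simp add: s2_def inv_stereo_def N_def)
  have cs: "s \<in> borel \<rightarrow>\<^sub>M borel"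
  proof -
    have "continuous_on UNIV s"
      using lp by (auto simp: local_parametrization_def homeomorphism_def)
    then show ?thesis by (rule borel_measurable_continuous_onI)
  qed
  have NS: "N \<in> ?S" by (simp add: N_def L(3))
  have eval: "emeasure M A = (\<integral>\<^sup>+y\<in>s -` A. ennreal (volume_density s y) \<partial>lborel)"
    if M: "is_riemannian_volume TYPE('k) ?S M" and A: "A \<in> sets (restrict_space borel ?S)" for M A
  proof -
    have sM: "sets M = sets (restrict_space borel ?S)"
      and em: "\<And>(\<phi> :: real^'k \<Rightarrow> 'b) E. local_parametrization \<phi> UNIV ?S \<Longrightarrow> E \<in> sets borel \<Longrightarrow>
        emeasure M (\<phi> ` E) = (\<integral>\<^sup>+y\<in>E. ennreal (volume_density \<phi> y) \<partial>lborel)"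
      using M unfolding is_riemannian_volume_def by auto
    have AB: "A \<in> sets borel" "A \<subseteq> ?S"
      using A by (auto simp: sets_restrict_space_iff)
    have Ns: "{N} \<in> sets M" using NS by (simp add: sM sets_restrict_space_iff)
    have "emeasure M {N} = emeasure M (s2 ` {0})" by (simp add: s20)
    also have "\<dots> = (\<integral>\<^sup>+y\<in>{0}. ennreal (volume_density s2 y) \<partial>lborel)"
      by (rule em[OF lp2]) simp
    also have "\<dots> = (\<integral>\<^sup>+y. 0 \<partial>(lborel :: (real^'k) measure))"
    proof (rule nn_integral_cong_AE)
      have "AE y in lborel. y \<noteq> (0 :: real^'k)" by (rule AE_lborel_singleton)
      then show "AE y in lborel. ennreal (volume_density s2 y) * indicator {0} y = 0"
        by eventually_elim simp
    qed
    finally have N0: "{N} \<in> null_sets M" using Ns by (auto simp: null_sets_def)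
    have "emeasure M A = emeasure M (A - {N})"
      using N0 A by (simp add: emeasure_Diff_null_set sM)
    also have "A - {N} = s ` (s -` A)"
      using rng AB(2) by (auto simp: image_iff)
    also have "emeasure M \<dots> = (\<integral>\<^sup>+y\<in>s -` A. ennreal (volume_density s y) \<partial>lborel)"
      using measurable_sets[OF cs AB(1)] by (intro em[OF lp]) simp
    finally show ?thesis .
  qed
  show ?thesis
  proof (rule measure_eqI)
    show "sets M1 = sets M2" using M1 M2 by (simp add: is_riemannian_volume_def)
    fix A assume "A \<in> sets M1"
    then have "A \<in> sets (restrict_space borel ?S)" using M1 by (simp add: is_riemannian_volume_def)
    then show "emeasure M1 A = emeasure M2 A" using eval M1 M2 by simp
  qed
qed

theorem is_riemannian_volume_sphere:
  assumes dim: "DIM('b::euclidean_space) = CARD('k::{finite,wellorder}) + 1"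
  shows "is_riemannian_volume TYPE('k) (sphere 0 1 :: 'b set)
    (riemannian_volume TYPE('k) (sphere 0 1))"
proof -
  have "DIM((real^'k::_) \<times> real) = DIM('b)" using dim by simp
  then obtain L :: "(real^'k::_) \<times> real \<Rightarrow> 'b" and L' where
    L: "linear L" "linear L'" "\<And>x. norm (L x) = norm x" "\<And>x. norm (L' x) = norm x"
       "\<And>x. L' (L x) = x" "\<And>x. L (L' x) = x"
    by (rule isomorphisms_UNIV_UNIV) (rule that)
  show ?thesis
    unfolding riemannian_volume_def
    by (rule theI[where P = "is_riemannian_volume TYPE('k) (sphere 0 1)"],
        rule is_riemannian_volume_sphere_exists[OF L],
        rule is_riemannian_volume_sphere_unique[OF dim _ is_riemannian_volume_sphere_exists[OF L]])
qed


section \<open>Constants\<close>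

definition const_A :: "nat \<Rightarrow> real" where
  "const_A m = 1 + sqrt pi * exp ((9 * real m - 3) / (4 * real m - 2)) / 2
                   * (2 + exp (1 / (4 * real m - 2)))"

definition const_A' :: "nat \<Rightarrow> real" where
  "const_A' m = 1 + sqrt pi * exp ((real m + 1) / (4 * real m - 2)) / 2
                   * (2 + exp (1 / (4 * real m - 2)))"

definition const_B :: "nat \<Rightarrow> real" where
  "const_B m = 1 + sqrt pi * exp (pi\<^sup>2 + (real m + 1) / (4 * real m - 2))"

definition const_B' :: "nat \<Rightarrow> real" where
  "const_B' m = 1 + sqrt pi * exp ((real m + 1) / (4 * real m - 2))"

end

theory Submission
  imports Defs "HOL-Probability.Distributions"
begin

text \<open>
  Write \<open>N = n + 1\<close> for the dimension of the ambient space and \<open>\<rho>(x)\<close> for the norm of the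
  coordinates of \<open>x\<close> in \<open>I\<close>. A great circle arc of length \<open>arcsin \<rho>(x) \<le> (\<pi>/2) \<rho>(x)\<close>
  joins \<open>x\<close> to the subsphere where these coordinates vanish
  (\<open>riemannian_dist_subsphere_le\<close>), so a point outside the neighbourhood satisfies
  \<open>\<rho>(x) \<ge> 2r/\<pi>\<close>. It remains to bound the probability of this event, and for that the exponential
  moment \<open>E exp (N x\<^sub>i\<^sup>2 / 4) \<le> sqrt 2\<close> of a single coordinate is enough: by convexity the mean of
  \<open>exp (N \<rho>\<^sup>2 / (4m))\<close> is at most the average of these moments over \<open>i \<in> I\<close>, and Markov's inequality
  gives the tail bound \<open>sqrt 2 * exp (- N r\<^sup>2 / (\<pi>\<^sup>2 m))\<close>.

  The exponential moment is obtained without integrating over the sphere. The volume is invariant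
  under isometries (\<open>distr_riemannian_volume_sphere\<close>), so \<open>x\<^sub>i\<close> has the same distribution as the
  component of \<open>x\<close> along the unit vector \<open>\<epsilon> / sqrt N\<close>, for every vector \<open>\<epsilon>\<close> of signs. Averaging over
  all \<open>\<epsilon>\<close> inside the integral reduces the claim to a pointwise inequality for random signs and one
  fixed unit vector \<open>x\<close>, a subgaussian Khinchine inequality
  (\<open>sum_exp_square_sign_vectors_le\<close>).

  The single Gaussian tail bound dominates all four bounds of the theorem: their constants are at
  least 2, the two Gaussian rates are smaller by a factor of at least 4, and completing the square
  compares it with the two exponential bounds.
\<close>

section \<open>Isometry invariance of the volume of the sphere\<close>

lemma frechet_derivative_linear_compose:
  fixes T :: "'b::euclidean_space \<Rightarrow> 'b" and \<phi> :: "'a::real_normed_vector \<Rightarrow> 'b"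
  assumes T: "linear T" and \<phi>: "\<phi> differentiable (at y)"
  shows "(T \<circ> \<phi>) differentiable (at y)"
    and "frechet_derivative (T \<circ> \<phi>) (at y) = T \<circ> frechet_derivative \<phi> (at y)"
proof -
  have "(\<phi> has_derivative frechet_derivative \<phi> (at y)) (at y)"
    using \<phi> frechet_derivative_works by blast
  moreover have "bounded_linear T"
    using T by (simp add: linear_conv_bounded_linear)
  ultimately have *: "(T \<circ> \<phi> has_derivative T \<circ> frechet_derivative \<phi> (at y)) (at y)"
    unfolding comp_def by (metis bounded_linear.has_derivative)
  then show "(T \<circ> \<phi>) differentiable (at y)"
    using differentiable_def by blast
  show "frechet_derivative (T \<circ> \<phi>) (at y) = T \<circ> frechet_derivative \<phi> (at y)"
    using frechet_derivative_at[OF *] by simp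
qed

lemma homeomorphism_orthogonal_sphere:
  fixes T :: "'b::euclidean_space \<Rightarrow> 'b"
  assumes T: "orthogonal_transformation T"
  shows "homeomorphism (sphere 0 1) (sphere 0 1) T (inv T)"
proof -
  have T': "orthogonal_transformation (inv T)" and b: "bij T"
    using T orthogonal_transformation_inv orthogonal_transformation_bij by blast+
  have TT: "inv T (T x) = x" "T (inv T x) = x" for x
    using b by (auto simp: bij_def surj_f_inv_f)
  have n: "norm (T x) = norm x" "norm (inv T x) = norm x" for x
    using T T' by (auto simp: orthogonal_transformation)
  show ?thesis
    by (rule homeomorphismI)
       (use TT n T T' in \<open>auto intro!: linear_continuous_on
          simp: linear_conv_bounded_linear[symmetric] orthogonal_transformation_linear\<close>)
qed

text \<open>The density only involves inner products of partial derivatives, which an isometry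
  preserves.\<close>

lemma local_parametrization_isometry:
  fixes T :: "'b::euclidean_space \<Rightarrow> 'b" and \<phi> :: "real^'k \<Rightarrow> 'b"
  assumes T: "orthogonal_transformation T" and \<phi>: "local_parametrization \<phi> U (sphere 0 1)"
  shows "local_parametrization (T \<circ> \<phi>) U (sphere 0 1)"
    and "y \<in> U \<Longrightarrow> volume_density (T \<circ> \<phi>) y = volume_density \<phi> y"
proof -
  let ?S = "sphere 0 1 :: 'b set"
  have lin: "linear T" and injT: "inj T"
    using T by (simp_all add: orthogonal_transformation_linear orthogonal_transformation_inj)
  obtain \<psi> where o: "openin (top_of_set ?S) (\<phi> ` U)" and h: "homeomorphism U (\<phi> ` U) \<phi> \<psi>"
    and d: "\<And>y. y \<in> U \<Longrightarrow> \<phi> differentiable (at y)"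
    and rest: "open U" "\<And>y. y \<in> U \<Longrightarrow> inj (frechet_derivative \<phi> (at y))"
      "\<And>v. continuous_on U (\<lambda>y. frechet_derivative \<phi> (at y) v)"
    using \<phi> unfolding local_parametrization_def by blast
  have fd: "(T \<circ> \<phi>) differentiable (at y)"
    "frechet_derivative (T \<circ> \<phi>) (at y) = T \<circ> frechet_derivative \<phi> (at y)" if "y \<in> U" for y
    using frechet_derivative_linear_compose[OF lin d[OF that]] by simp_all
  note hT = homeomorphism_orthogonal_sphere[OF T]
  have hT': "homeomorphism (\<phi> ` U) (T ` \<phi> ` U) T (inv T)"
    using homeomorphism_of_subsets[OF hT, of "\<phi> ` U" "T ` \<phi> ` U"] openin_imp_subset[OF o]
      homeomorphism_image1[OF hT] by blast
  show "local_parametrization (T \<circ> \<phi>) U ?S"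
    unfolding local_parametrization_def
  proof (intro conjI ballI allI)
    show "openin (top_of_set ?S) ((T \<circ> \<phi>) ` U)"
      using homeomorphism_imp_open_map[OF hT o] by (simp add: image_comp)
    show "\<exists>\<psi>. homeomorphism U ((T \<circ> \<phi>) ` U) (T \<circ> \<phi>) \<psi>"
      using homeomorphism_compose[OF h hT'] by (auto simp: image_comp)
    show "inj (frechet_derivative (T \<circ> \<phi>) (at y))" if "y \<in> U" for y
      unfolding fd(2)[OF that] using rest(2)[OF that] injT by (rule inj_compose[rotated])
    show "continuous_on U (\<lambda>y. frechet_derivative (T \<circ> \<phi>) (at y) v)" for v
    proof -
      have "continuous_on U (\<lambda>y. T (frechet_derivative \<phi> (at y) v))"
        using linear_continuous_on_compose[OF rest(3) lin] .
      then show ?thesis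
        by (rule continuous_on_eq) (simp add: fd(2))
    qed
  qed (use rest(1) fd(1) in auto)
  show "volume_density (T \<circ> \<phi>) y = volume_density \<phi> y" if "y \<in> U"
    using T by (simp add: volume_density_def gram_matrix_def fd(2)[OF that]
        orthogonal_transformation_def)
qed

lemma
  fixes f :: "'b::euclidean_space \<Rightarrow> ennreal"
  assumes dim: "DIM('b) = CARD('k::{finite,wellorder}) + 1"
  defines "M \<equiv> riemannian_volume TYPE('k) (sphere (0 :: 'b) 1)"
  shows sets_riemannian_volume_sphere: "sets M = sets (restrict_space borel (sphere 0 1))"
    and space_riemannian_volume_sphere: "space M = sphere 0 1"
    and borel_measurable_riemannian_volume_sphere:
      "f \<in> borel_measurable borel \<Longrightarrow> f \<in> borel_measurable M"
proof -
  show setsM: "sets M = sets (restrict_space borel (sphere 0 1))"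
    using is_riemannian_volume_sphere[OF dim] by (simp add: M_def is_riemannian_volume_def)
  show "space M = sphere 0 1"
    using sets_eq_imp_space_eq[OF setsM] by (simp add: space_restrict_space)
  show "f \<in> borel_measurable M" if "f \<in> borel_measurable borel"
    using measurable_restrict_space1[OF that] measurable_cong_sets[OF setsM refl] by blast
qed

text \<open>The pushforward of the volume under an isometry \<open>T\<close> again has the right value in every
  local parametrization \<open>\<phi>\<close>, since \<open>inv T \<circ> \<phi>\<close> is a local parametrization with the
  same density. Uniqueness of the volume then gives invariance, without a computation of the volume
  of any set.\<close>

lemma distr_riemannian_volume_sphere:
  fixes T :: "'b::euclidean_space \<Rightarrow> 'b"
  assumes dim: "DIM('b) = CARD('k::{finite,wellorder}) + 1" and T: "orthogonal_transformation T"
  defines "M \<equiv> riemannian_volume TYPE('k) (sphere (0 :: 'b) 1)"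
  shows "T \<in> M \<rightarrow>\<^sub>M M" and "distr M M T = M"
proof -
  let ?S = "sphere 0 1 :: 'b set"
  have vol: "is_riemannian_volume TYPE('k) ?S M"
    unfolding M_def by (rule is_riemannian_volume_sphere[OF dim])
  note setsM = sets_riemannian_volume_sphere[OF dim, folded M_def]
    and spaceM = space_riemannian_volume_sphere[OF dim, folded M_def]
  have meas: "T \<in> M \<rightarrow>\<^sub>M M" if T: "orthogonal_transformation T" for T :: "'b \<Rightarrow> 'b"
  proof -
    have "continuous_on ?S T"
      using homeomorphism_orthogonal_sphere[OF T] by (simp add: homeomorphism_def)
    then have "T \<in> restrict_space borel ?S \<rightarrow>\<^sub>M borel"
      by (rule borel_measurable_continuous_on_restrict)
    then have "T \<in> restrict_space borel ?S \<rightarrow>\<^sub>M restrict_space borel ?S"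
      using T by (intro measurable_restrict_space2)
        (auto simp: space_restrict_space orthogonal_transformation)
    then show ?thesis
      using measurable_cong_sets[OF setsM setsM] by blast
  qed
  show mT: "T \<in> M \<rightarrow>\<^sub>M M"
    using meas[OF T] .
  define T' where "T' = inv T"
  have T': "orthogonal_transformation T'"
    using T by (simp add: T'_def orthogonal_transformation_inv)
  have "is_riemannian_volume TYPE('k) ?S (distr M M T)"
    unfolding is_riemannian_volume_def
  proof (intro conjI allI impI)
    show "sets (distr M M T) = sets (restrict_space borel ?S)"
      using setsM by simp
    fix \<phi> :: "real^'k::_ \<Rightarrow> 'b" and U E
    assume \<phi>: "local_parametrization \<phi> U ?S" and E: "E \<in> sets borel" "E \<subseteq> U"
    have "\<phi> ` U \<subseteq> ?S"
      using \<phi> openin_imp_subset unfolding local_parametrization_def by blast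
    then have "norm (\<phi> y) = 1" if "y \<in> U" for y
      using that by (simp add: image_subset_iff)
    moreover have "norm (T' x) = norm x" for x
      using T' by (simp add: orthogonal_transformation)
    moreover have "T -` (\<phi> ` E) = T' ` \<phi> ` E"
      unfolding T'_def by (rule bij_vimage_eq_inv_image[OF orthogonal_transformation_bij[OF T]])
    ultimately have pre: "T -` (\<phi> ` E) \<inter> space M = (T' \<circ> \<phi>) ` E"
      using E(2) by (auto simp: spaceM)
    have em: "emeasure M (\<eta> ` E) = (\<integral>\<^sup>+y\<in>E. ennreal (volume_density \<eta> y) \<partial>lborel)"
      if "local_parametrization \<eta> U ?S" for \<eta> :: "real^'k::_ \<Rightarrow> 'b"
      using vol that E unfolding is_riemannian_volume_def by blast
    show "emeasure (distr M M T) (\<phi> ` E) = (\<integral>\<^sup>+y\<in>E. ennreal (volume_density \<phi> y) \<partial>lborel)"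
    proof (cases "\<phi> ` E \<in> sets M")
      case True
      have "emeasure (distr M M T) (\<phi> ` E) = emeasure M ((T' \<circ> \<phi>) ` E)"
        using emeasure_distr[OF mT True] pre by simp
      also have "\<dots> = (\<integral>\<^sup>+y\<in>E. ennreal (volume_density (T' \<circ> \<phi>) y) \<partial>lborel)"
        by (rule em[OF local_parametrization_isometry(1)[OF T' \<phi>]])
      also have "\<dots> = (\<integral>\<^sup>+y\<in>E. ennreal (volume_density \<phi> y) \<partial>lborel)"
        using local_parametrization_isometry(2)[OF T' \<phi>] E(2)
        by (intro nn_integral_cong) (auto simp: indicator_def)
      finally show ?thesis .
    next
      case False
      \<comment> \<open>Outside the \<open>\<sigma>\<close>-algebra both measures are 0 by convention; this avoids proving that
        \<open>\<phi> ` E\<close> is a Borel set.\<close>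
      then show ?thesis
        using em[OF \<phi>] by (simp add: emeasure_notin_sets)
    qed
  qed
  then show "distr M M T = M"
    using is_riemannian_volume_sphere_unique[OF dim] vol by blast
qed


section \<open>A Gaussian bound for random signs\<close>

text \<open>Integrating \<open>tanh t \<le> t\<close>, where \<open>tanh\<close> is the derivative of \<open>ln \<circ> cosh\<close>.\<close>

lemma cosh_le_exp_half_square: "cosh x \<le> exp (x\<^sup>2 / 2)" for x :: real
proof -
  have tanh_le: "tanh t \<le> t" if "t \<ge> 0" for t :: real
  proof -
    have "0 - tanh 0 \<le> t - tanh t"
    proof (rule DERIV_nonneg_imp_nondecreasing[OF that])
      show "\<exists>y. ((\<lambda>s. s - tanh s) has_real_derivative y) (at s) \<and> 0 \<le> y" for s :: real
        by (intro exI[of _ "(tanh s)\<^sup>2"] conjI) (auto intro!: derivative_eq_intros)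
    qed
    then show ?thesis by simp
  qed
  have "ln (cosh t) \<le> t\<^sup>2 / 2" if "t \<ge> 0" for t :: real
  proof -
    have "0\<^sup>2 / 2 - ln (cosh 0) \<le> t\<^sup>2 / 2 - ln (cosh t)"
    proof (rule DERIV_nonneg_imp_nondecreasing[OF that])
      fix s :: real assume "0 \<le> s"
      moreover have "((\<lambda>s. s\<^sup>2 / 2 - ln (cosh s)) has_real_derivative s - tanh s) (at s)"
        unfolding tanh_def by (rule derivative_eq_intros refl | simp add: cosh_real_pos)+
      ultimately show "\<exists>y. ((\<lambda>s. s\<^sup>2 / 2 - ln (cosh s)) has_real_derivative y) (at s) \<and> 0 \<le> y"
        using tanh_le[of s] by auto
    qed
    then show ?thesis by simp
  qed
  from this[of "\<bar>x\<bar>"] have "ln (cosh x) \<le> x\<^sup>2 / 2"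
    by simp
  then show ?thesis
    by (metis cosh_real_pos exp_le_cancel_iff exp_ln)
qed

definition sign_vectors :: "('N \<Rightarrow> real) set" where
  "sign_vectors = PiE UNIV (\<lambda>_. {-1, 1})"

lemma card_sign_vectors: "card (sign_vectors :: ('N::finite \<Rightarrow> real) set) = 2 ^ CARD('N)"
  unfolding sign_vectors_def
  by (simp add: card_PiE card_insert_if flip: numeral_2_eq_2)

text \<open>By independence of the signs, the moment generating function is \<open>2 ^ CARD('N)\<close> times the
  product of the \<open>cosh (x $ i)\<close>.\<close>

lemma sum_exp_sign_vectors_le:
  fixes x :: "real^'N::finite"
  shows "(\<Sum>\<epsilon>\<in>sign_vectors. exp (\<Sum>i\<in>UNIV. \<epsilon> i * x $ i)) \<le> 2 ^ CARD('N) * exp ((norm x)\<^sup>2 / 2)"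
proof -
  have "(\<Sum>\<epsilon>\<in>sign_vectors. exp (\<Sum>i\<in>UNIV. \<epsilon> i * x $ i)) =
      (\<Sum>\<epsilon>\<in>PiE UNIV (\<lambda>_. {-1, 1}). \<Prod>i\<in>UNIV. exp (\<epsilon> i * x $ i))"
    by (simp add: sign_vectors_def exp_sum)
  also have "\<dots> = (\<Prod>i\<in>UNIV. \<Sum>s\<in>{-1, 1}. exp (s * x $ i))"
    by (rule prod_sum_PiE[symmetric]) auto
  also have "\<dots> = (\<Prod>i\<in>UNIV. 2 * cosh (x $ i))"
    by (intro prod.cong) (simp_all add: cosh_def scaleR_conv_of_real)
  also have "\<dots> \<le> (\<Prod>i\<in>UNIV. 2 * exp ((x $ i)\<^sup>2 / 2))"
    by (intro prod_mono) (auto simp: cosh_le_exp_half_square less_imp_le[OF cosh_real_pos])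
  also have "\<dots> = 2 ^ CARD('N) * exp ((norm x)\<^sup>2 / 2)"
    by (simp add: prod.distrib exp_sum[symmetric] sum_divide_distrib[symmetric]
        power2_norm_eq_inner inner_vec_def flip: power2_eq_square)
  finally show ?thesis .
qed

text \<open>The square in the exponent is linearised by a standard Gaussian variable \<open>g\<close>:
  \<open>exp (a\<^sup>2 / 2) = E exp (a * g)\<close>. The previous bound applies for fixed \<open>g\<close>, and what is left is
  \<open>E exp (g\<^sup>2 / 4) = sqrt 2\<close>. Both expectations are read off from normal densities: up to a
  constant factor, \<open>exp (a * g)\<close> tilts the standard normal density to the one with mean \<open>a\<close>, and
  \<open>exp (g\<^sup>2 / 4)\<close> turns it into the one with variance 2.\<close>

lemma sum_exp_square_sign_vectors_le:
  fixes x :: "real^'N::finite"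
  assumes x: "norm x = 1"
  shows "(\<Sum>\<epsilon>\<in>sign_vectors. exp ((\<Sum>i\<in>UNIV. \<epsilon> i * x $ i)\<^sup>2 / 4)) \<le> sqrt 2 * 2 ^ CARD('N)"
proof -
  define a where "a \<epsilon> = (\<Sum>i\<in>UNIV. \<epsilon> i * x $ i) / sqrt 2" for \<epsilon>
  have tilt: "exp ((a \<epsilon>)\<^sup>2 / 2) * normal_density (a \<epsilon>) 1 g = std_normal_density g * exp (a \<epsilon> * g)" for \<epsilon> g
  proof -
    have "(a \<epsilon>)\<^sup>2 / 2 + - (g - a \<epsilon>)\<^sup>2 / 2 = - g\<^sup>2 / 2 + a \<epsilon> * g"
      by (simp add: power2_eq_square field_simps)
    then have "exp ((a \<epsilon>)\<^sup>2 / 2) * exp (- (g - a \<epsilon>)\<^sup>2 / 2) = exp (- g\<^sup>2 / 2) * exp (a \<epsilon> * g)"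
      unfolding exp_add[symmetric] by simp
    then show ?thesis
      by (simp add: normal_density_def)
  qed
  have le: "(\<Sum>\<epsilon>\<in>sign_vectors. exp ((a \<epsilon>)\<^sup>2 / 2) * normal_density (a \<epsilon>) 1 g)
      \<le> sqrt 2 * 2 ^ CARD('N) * normal_density 0 (sqrt 2) g" for g
  proof -
    have "(\<Sum>\<epsilon>\<in>sign_vectors. exp (a \<epsilon> * g)) =
        (\<Sum>\<epsilon>\<in>sign_vectors. exp (\<Sum>i\<in>UNIV. \<epsilon> i * ((g / sqrt 2) *\<^sub>R x) $ i))"
      by (simp add: a_def sum_distrib_right sum_distrib_left sum_divide_distrib mult_ac)
    also have "\<dots> \<le> 2 ^ CARD('N) * exp ((norm ((g / sqrt 2) *\<^sub>R x))\<^sup>2 / 2)"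
      by (rule sum_exp_sign_vectors_le)
    also have "(norm ((g / sqrt 2) *\<^sub>R x))\<^sup>2 / 2 = g\<^sup>2 / 4"
      by (simp add: x power_divide)
    finally have "(\<Sum>\<epsilon>\<in>sign_vectors. exp ((a \<epsilon>)\<^sup>2 / 2) * normal_density (a \<epsilon>) 1 g) \<le>
        std_normal_density g * (2 ^ CARD('N) * exp (g\<^sup>2 / 4))"
      unfolding tilt sum_distrib_left[symmetric] by (intro mult_left_mono) auto
    also have "std_normal_density g * exp (g\<^sup>2 / 4) = sqrt 2 * normal_density 0 (sqrt 2) g"
    proof -
      have "exp (- g\<^sup>2 / 2) * exp (g\<^sup>2 / 4) = exp (- g\<^sup>2 / 4)"
        by (simp add: exp_add[symmetric])
      moreover have "sqrt (2 * pi * (sqrt 2)\<^sup>2) = sqrt 2 * sqrt (2 * pi)"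
        by (simp add: real_sqrt_mult)
      ultimately show ?thesis
        by (simp add: normal_density_def)
    qed
    then have "std_normal_density g * (2 ^ CARD('N) * exp (g\<^sup>2 / 4)) =
        sqrt 2 * 2 ^ CARD('N) * normal_density 0 (sqrt 2) g"
      by (simp add: mult_ac)
    finally show ?thesis .
  qed
  have "(\<Sum>\<epsilon>\<in>sign_vectors. exp ((\<Sum>i\<in>UNIV. \<epsilon> i * x $ i)\<^sup>2 / 4)) =
      (\<Sum>\<epsilon>\<in>sign_vectors. exp ((a \<epsilon>)\<^sup>2 / 2))"
    by (simp add: a_def power_divide)
  also have "\<dots> = (\<integral>g. (\<Sum>\<epsilon>\<in>sign_vectors. exp ((a \<epsilon>)\<^sup>2 / 2) * normal_density (a \<epsilon>) 1 g) \<partial>lborel)"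
    by (subst Bochner_Integration.integral_sum) auto
  also have "\<dots> \<le> (\<integral>g. sqrt 2 * 2 ^ CARD('N) * normal_density 0 (sqrt 2) g \<partial>lborel)"
    by (intro integral_mono le) auto
  also have "\<dots> = sqrt 2 * 2 ^ CARD('N)"
    by simp
  finally show ?thesis .
qed


section \<open>Concentration of coordinates on the sphere\<close>

text \<open>Let \<open>N = CARD('N)\<close>. For each sign vector \<open>\<epsilon>\<close> an isometry maps \<open>sqrt N\<close> times the \<open>i\<close>-th basis vector to \<open>\<epsilon>\<close>, so
  \<open>sqrt N * x $ i\<close> and the sum of the \<open>\<epsilon> j * x $ j\<close> are equidistributed. The average over \<open>\<epsilon>\<close> is
  bounded at every point of the sphere.\<close>

lemma nn_integral_exp_coordinate_square_le:
  assumes dim: "CARD('N::finite) = CARD('k::{finite,wellorder}) + 1"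
  defines "M \<equiv> riemannian_volume TYPE('k) (sphere (0 :: real^'N) 1)"
  shows "(\<integral>\<^sup>+x. ennreal (exp (real CARD('N) * (x $ i)\<^sup>2 / 4)) \<partial>M) \<le> ennreal (sqrt 2) * emeasure M (space M)"
proof -
  let ?S = "sphere 0 1 :: (real^'N) set" and ?N = "real CARD('N)"
  have dim': "DIM(real^'N) = CARD('k) + 1"
    using dim by simp
  note spaceM = space_riemannian_volume_sphere[OF dim', folded M_def]
    and measM = borel_measurable_riemannian_volume_sphere[OF dim', folded M_def]
  have rot: "(\<integral>\<^sup>+x. ennreal (exp ((\<Sum>j\<in>UNIV. \<epsilon> j * x $ j)\<^sup>2 / 4)) \<partial>M) =
      (\<integral>\<^sup>+x. ennreal (exp (?N * (x $ i)\<^sup>2 / 4)) \<partial>M)" if "\<epsilon> \<in> sign_vectors" for \<epsilon>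
  proof -
    define v :: "real^'N" where "v = (\<chi> j. \<epsilon> j)"
    have "\<epsilon> j * \<epsilon> j = 1" for j
      using that by (auto simp: sign_vectors_def PiE_def Pi_def dest!: spec[of _ j])
    then have nv: "norm v = sqrt ?N"
      by (simp add: v_def norm_eq_sqrt_inner inner_vec_def)
    define e :: "real^'N" where "e = sqrt ?N *\<^sub>R axis i 1"
    have "norm e = norm v"
      by (simp add: nv e_def)
    then obtain T where T: "orthogonal_transformation T" "T e = v"
      using orthogonal_transformation_exists[of e v] by metis
    note inv = distr_riemannian_volume_sphere[OF dim' T(1), folded M_def]
    have "(\<integral>\<^sup>+x. ennreal (exp ((\<Sum>j\<in>UNIV. \<epsilon> j * x $ j)\<^sup>2 / 4)) \<partial>M) =
        (\<integral>\<^sup>+x. ennreal (exp ((x \<bullet> v)\<^sup>2 / 4)) \<partial>distr M M T)"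
      unfolding inv(2) by (simp add: v_def inner_vec_def mult.commute)
    also have "\<dots> = (\<integral>\<^sup>+x. ennreal (exp ((T x \<bullet> v)\<^sup>2 / 4)) \<partial>M)"
      by (rule nn_integral_distr[OF inv(1)]) (subst measurable_distr_eq1, rule measM, measurable)
    also have "\<dots> = (\<integral>\<^sup>+x. ennreal (exp (?N * (x $ i)\<^sup>2 / 4)) \<partial>M)"
    proof -
      have "T x \<bullet> v = sqrt ?N * x $ i" for x
        using T(1) unfolding T(2)[symmetric] orthogonal_transformation_def
        by (simp add: e_def inner_axis)
      then show ?thesis
        by (simp add: power_mult_distrib)
    qed
    finally show ?thesis .
  qed
  let ?J = "\<integral>\<^sup>+x. ennreal (exp (?N * (x $ i)\<^sup>2 / 4)) \<partial>M"
  have "ennreal (2 ^ CARD('N)) * ?J = (\<Sum>\<epsilon>\<in>(sign_vectors :: ('N \<Rightarrow> real) set). ?J)"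
    by (simp add: card_sign_vectors ennreal_of_nat_eq_real_of_nat)
  also have "\<dots> = (\<Sum>\<epsilon>\<in>sign_vectors. \<integral>\<^sup>+x. ennreal (exp ((\<Sum>j\<in>UNIV. \<epsilon> j * x $ j)\<^sup>2 / 4)) \<partial>M)"
    by (simp add: rot)
  also have "\<dots> = (\<integral>\<^sup>+x. (\<Sum>\<epsilon>\<in>sign_vectors. ennreal (exp ((\<Sum>j\<in>UNIV. \<epsilon> j * x $ j)\<^sup>2 / 4))) \<partial>M)"
    by (intro nn_integral_sum[symmetric] measM) measurable
  also have "\<dots> \<le> (\<integral>\<^sup>+x. ennreal (sqrt 2 * 2 ^ CARD('N)) \<partial>M)"
    using sum_exp_square_sign_vectors_le
    by (intro nn_integral_mono) (simp add: spaceM sum_ennreal ennreal_leI)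
  also have "\<dots> = ennreal (2 ^ CARD('N)) * (ennreal (sqrt 2) * emeasure M (space M))"
    by (simp add: ennreal_mult' mult_ac)
  finally show ?thesis
    by (subst (asm) ennreal_mult_le_mult_iff) auto
qed

lemma exp_average_le:
  fixes f :: "'a \<Rightarrow> real"
  assumes "finite I" "I \<noteq> {}"
  shows "exp ((\<Sum>i\<in>I. f i) / card I) \<le> (\<Sum>i\<in>I. exp (f i)) / card I"
  using convex_on_sum[OF assms exp_convex, of "\<lambda>_. 1 / card I" f] assms
  by (simp add: sum_divide_distrib)

text \<open>Markov's inequality for \<open>exp\<close> of the average over \<open>i \<in> I\<close> of \<open>CARD('N) (x $ i)\<^sup>2 / 4\<close>. Taking the
  average instead of a union bound keeps the constant independent of \<open>card I\<close>.\<close>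

lemma emeasure_coordinates_square_ge_le:
  fixes I :: "'N::finite set" and t :: real
  assumes dim: "CARD('N) = CARD('k::{finite,wellorder}) + 1" and I: "I \<noteq> {}"
  defines "M \<equiv> riemannian_volume TYPE('k) (sphere (0 :: real^'N) 1)"
  shows "{x \<in> sphere 0 1. t \<le> (\<Sum>i\<in>I. (x $ i)\<^sup>2)} \<in> sets M"
    and "emeasure M {x \<in> sphere 0 1. t \<le> (\<Sum>i\<in>I. (x $ i)\<^sup>2)}
      \<le> ennreal (sqrt 2 * exp (- (real CARD('N) * t / (4 * card I)))) * emeasure M (sphere 0 1)"
proof -
  let ?S = "sphere 0 1 :: (real^'N) set"
  let ?D = "{x \<in> ?S. t \<le> (\<Sum>i\<in>I. (x $ i)\<^sup>2)}"
  let ?c = "real CARD('N) / 4"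
  have dim': "DIM(real^'N) = CARD('k) + 1"
    using dim by simp
  note setsM = sets_riemannian_volume_sphere[OF dim', folded M_def]
    and spaceM = space_riemannian_volume_sphere[OF dim', folded M_def]
    and measM = borel_measurable_riemannian_volume_sphere[OF dim', folded M_def]
  have "?D \<in> sets borel"
    by measurable
  then show D: "?D \<in> sets M"
    unfolding setsM by (auto simp: sets_restrict_space_iff)
  have card: "real (card I) > 0"
    using I by (simp add: card_gt_0_iff)
  define W where "W x = exp (?c * (\<Sum>i\<in>I. (x $ i)\<^sup>2) / card I)" for x :: "real^'N"
  define c where "c = exp (- (?c * t / card I))"
  have mW: "(\<lambda>x. ennreal (W x)) \<in> borel_measurable M"
    unfolding W_def by (rule measM) measurable
  have "emeasure M ?D \<le> emeasure M {x \<in> ?S. 1 \<le> ennreal c * ennreal (W x)}"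
  proof (rule emeasure_mono)
    show "?D \<subseteq> {x \<in> ?S. 1 \<le> ennreal c * ennreal (W x)}"
    proof safe
      fix x :: "real^'N" assume "t \<le> (\<Sum>i\<in>I. (x $ i)\<^sup>2)"
      then have "?c * t / card I \<le> ?c * (\<Sum>i\<in>I. (x $ i)\<^sup>2) / card I"
        by (intro divide_right_mono mult_left_mono) auto
      then have "1 \<le> c * W x"
        by (simp add: c_def W_def exp_add[symmetric])
      then show "1 \<le> ennreal c * ennreal (W x)"
        by (simp add: c_def ennreal_mult'[symmetric] ennreal_leI[of 1, simplified])
    qed
    have "{x \<in> space M. 1 \<le> ennreal c * ennreal (W x)} \<in> sets M"
      using mW by measurable
    then show "{x \<in> ?S. 1 \<le> ennreal c * ennreal (W x)} \<in> sets M"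
      by (simp add: spaceM)
  qed
  also have "\<dots> \<le> ennreal c * (\<integral>\<^sup>+x. ennreal (W x) * indicator ?S x \<partial>M)"
    using mW sets.top[of M] unfolding spaceM by (intro nn_integral_Markov_inequality) auto
  also have "(\<integral>\<^sup>+x. ennreal (W x) * indicator ?S x \<partial>M) = (\<integral>\<^sup>+x. ennreal (W x) \<partial>M)"
    by (intro nn_integral_cong) (simp add: spaceM indicator_def)
  also have "\<dots> \<le> (\<integral>\<^sup>+x. ennreal (1 / card I) * (\<Sum>i\<in>I. ennreal (exp (real CARD('N) * (x $ i)\<^sup>2 / 4))) \<partial>M)"
  proof (rule nn_integral_mono)
    fix x :: "real^'N"
    have "W x \<le> 1 / card I * (\<Sum>i\<in>I. exp (real CARD('N) * (x $ i)\<^sup>2 / 4))"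
      using exp_average_le[OF finite I, of "\<lambda>i. real CARD('N) * (x $ i)\<^sup>2 / 4"]
      by (simp add: W_def sum_distrib_left sum_divide_distrib mult_ac)
    then show "ennreal (W x) \<le> ennreal (1 / card I) * (\<Sum>i\<in>I. ennreal (exp (real CARD('N) * (x $ i)\<^sup>2 / 4)))"
      by (simp add: sum_ennreal ennreal_mult'[symmetric] ennreal_leI sum_nonneg)
  qed
  also have "\<dots> = ennreal (1 / card I) * (\<Sum>i\<in>I. \<integral>\<^sup>+x. ennreal (exp (real CARD('N) * (x $ i)\<^sup>2 / 4)) \<partial>M)"
    by (subst nn_integral_cmult, (intro measM; measurable), subst nn_integral_sum) (intro measM, measurable)
  also have "\<dots> \<le> ennreal (1 / card I) * (\<Sum>i\<in>I. ennreal (sqrt 2) * emeasure M ?S)"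
    using nn_integral_exp_coordinate_square_le[OF dim, folded M_def]
    by (intro mult_left_mono sum_mono) (simp_all add: spaceM)
  also have "\<dots> = ennreal (1 / card I * card I) * (ennreal (sqrt 2) * emeasure M ?S)"
    by (subst ennreal_mult') (simp_all add: ennreal_of_nat_eq_real_of_nat mult.assoc)
  also have "1 / card I * card I = (1 :: real)"
    using I by simp
  finally have "emeasure M ?D \<le> ennreal c * (ennreal (sqrt 2) * emeasure M ?S)"
    by (simp add: mult_left_mono)
  then show "emeasure M ?D
      \<le> ennreal (sqrt 2 * exp (- (real CARD('N) * t / (4 * card I)))) * emeasure M ?S"
    by (simp add: c_def ennreal_mult mult_ac)
qed

section \<open>Distance to a subsphere\<close>

text \<open>Jordan's inequality \<open>sin y \<ge> 2 y / \<pi>\<close> on \<open>[0, \<pi>/2]\<close>, from concavity of the sine.\<close>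

lemma arcsin_le_half_pi_mult:
  assumes "0 \<le> x" "x \<le> 1" shows "arcsin x \<le> pi / 2 * x"
proof -
  define t where "t = 2 / pi * arcsin x"
  have as: "0 \<le> arcsin x" "arcsin x \<le> pi / 2"
    using assms arcsin_bounded[of x] arcsin_le_arcsin[of 0 x] by auto
  have t: "0 \<le> t" "t \<le> 1" "arcsin x = t * (pi / 2)"
    using as by (auto simp: t_def field_simps)
  have "convex_on {0..pi/2} (\<lambda>y. - sin y)"
    by (rule f''_ge0_imp_convex[where f' = "\<lambda>y. - cos y" and f'' = sin])
       (auto intro!: derivative_eq_intros sin_ge_zero)
  from convex_onD[OF this, of t 0 "pi / 2"] have "t \<le> sin (t * (pi / 2))"
    using t by simp
  also have "\<dots> = x"
    using assms unfolding t(3)[symmetric] by simp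
  finally show ?thesis
    using t(3) by (simp add: mult_right_mono mult.commute)
qed

lemma riemannian_dist_le_length:
  assumes "valid_path \<gamma>" "path_image \<gamma> \<subseteq> S" "pathstart \<gamma> = x" "pathfinish \<gamma> = y"
  shows "riemannian_dist S x y \<le> integral {0..1} (\<lambda>t. norm (vector_derivative \<gamma> (at t)))"
  unfolding riemannian_dist_def
proof (rule cInf_lower)
  have "integral {0..1} (\<lambda>t. norm (vector_derivative \<delta> (at t))) \<ge> 0" for \<delta> :: "real \<Rightarrow> 'a"
    by (cases "(\<lambda>t. norm (vector_derivative \<delta> (at t))) integrable_on {0..1}")
       (simp_all add: integral_nonneg not_integrable_integral)
  then show "bdd_below {integral {0..1} (\<lambda>t. norm (vector_derivative \<gamma> (at t))) | \<gamma>.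
      valid_path \<gamma> \<and> path_image \<gamma> \<subseteq> S \<and> pathstart \<gamma> = x \<and> pathfinish \<gamma> = y}"
    by (intro bdd_belowI[of _ 0]) auto
qed (use assms in blast)

text \<open>The great circle arc from the first point to \<open>v\<close> has constant speed \<open>\<theta>\<close>.\<close>

lemma riemannian_dist_sphere_le_angle:
  fixes u v :: "'b::euclidean_space"
  assumes u: "norm u = 1" and v: "norm v = 1" and uv: "u \<bullet> v = 0" and \<theta>: "\<theta> \<ge> 0"
  shows "riemannian_dist (sphere 0 1) (sin \<theta> *\<^sub>R u + cos \<theta> *\<^sub>R v) v \<le> \<theta>"
proof -
  define \<gamma> where "\<gamma> t = sin ((1 - t) * \<theta>) *\<^sub>R u + cos ((1 - t) * \<theta>) *\<^sub>R v" for t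
  define \<gamma>' where "\<gamma>' t = (- \<theta> * cos ((1 - t) * \<theta>)) *\<^sub>R u + (\<theta> * sin ((1 - t) * \<theta>)) *\<^sub>R v" for t
  have nrm: "norm (a *\<^sub>R u + b *\<^sub>R v) = sqrt (a\<^sup>2 + b\<^sup>2)" for a b
    using u v uv by (simp add: norm_eq_sqrt_inner norm_eq_1 inner_add_left inner_add_right
        inner_commute[of v u] power2_eq_square)
  have der: "(\<gamma> has_vector_derivative \<gamma>' t) (at t)" for t
    unfolding \<gamma>_def \<gamma>'_def by (auto intro!: derivative_eq_intros simp: mult.commute)
  have "\<gamma> C1_differentiable_on {0..1}"
    unfolding C1_differentiable_on_def using der
    by (intro exI[of _ \<gamma>'] conjI) (auto simp: \<gamma>'_def[abs_def] intro!: continuous_intros)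
  then have "valid_path \<gamma>"
    by (simp add: valid_path_def C1_differentiable_imp_piecewise)
  moreover have "path_image \<gamma> \<subseteq> sphere 0 1"
    by (auto simp: path_image_def \<gamma>_def nrm)
  moreover have "pathstart \<gamma> = sin \<theta> *\<^sub>R u + cos \<theta> *\<^sub>R v" "pathfinish \<gamma> = v"
    by (simp_all add: pathstart_def pathfinish_def \<gamma>_def)
  ultimately have "riemannian_dist (sphere 0 1) (sin \<theta> *\<^sub>R u + cos \<theta> *\<^sub>R v) v
      \<le> integral {0..1} (\<lambda>t. norm (vector_derivative \<gamma> (at t)))"
    by (rule riemannian_dist_le_length)
  moreover have "norm (vector_derivative \<gamma> (at t)) = \<theta>" for t
  proof -
    have "(- \<theta> * cos ((1 - t) * \<theta>))\<^sup>2 + (\<theta> * sin ((1 - t) * \<theta>))\<^sup>2 = \<theta>\<^sup>2"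
      by (simp add: power_mult_distrib distrib_left[symmetric])
    then show ?thesis
      unfolding vector_derivative_at[OF der] \<gamma>'_def nrm using \<theta> by simp
  qed
  ultimately show ?thesis by simp
qed

text \<open>Polar decomposition of the restriction of \<open>x\<close> to the coordinates in \<open>J\<close>. If the restriction
  vanishes, any unit vector supported in \<open>J\<close> serves as its direction, and \<open>J \<noteq> {}\<close> provides one.\<close>

lemma unit_vector_of_coordinates:
  fixes x :: "real^'N::finite"
  assumes "J \<noteq> {}"
  obtains u :: "real^'N" where "norm u = 1" "\<And>i. i \<notin> J \<Longrightarrow> u $ i = 0"
    "(\<chi> i. if i \<in> J then x $ i else 0) = sqrt (\<Sum>i\<in>J. (x $ i)\<^sup>2) *\<^sub>R u"
proof -
  define p :: "real^'N" where "p = (\<chi> i. if i \<in> J then x $ i else 0)"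
  have "(norm p)\<^sup>2 = (\<Sum>i\<in>UNIV. if i \<in> J then (x $ i)\<^sup>2 else 0)"
    unfolding power2_norm_eq_inner inner_vec_def p_def
    by (intro sum.cong) (auto simp: power2_eq_square)
  also have "\<dots> = (\<Sum>i\<in>J. (x $ i)\<^sup>2)"
    by (simp add: sum.If_cases)
  finally have np: "sqrt (\<Sum>i\<in>J. (x $ i)\<^sup>2) = norm p"
    by (metis norm_ge_zero real_sqrt_unique)
  show ?thesis
  proof (cases "p = 0")
    case True
    obtain j where "j \<in> J"
      using assms by blast
    then have "axis j 1 $ i = (0 :: real)" if "i \<notin> J" for i
      using that by (auto simp: axis_def)
    then show ?thesis
      using True np by (intro that[of "axis j 1"]) (simp_all add: p_def[symmetric])
  next
    case False
    then show ?thesis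
      by (intro that[of "p /\<^sub>R norm p"]) (simp_all add: np p_def[symmetric], simp add: p_def)
  qed
qed

lemma riemannian_dist_subsphere_le:
  fixes x :: "real^'N::finite"
  assumes x: "norm x = 1" and I: "I \<noteq> {}" "I \<noteq> UNIV"
  obtains a where "norm a = 1" "\<forall>i\<in>I. a $ i = 0"
    "riemannian_dist (sphere 0 1) x a \<le> pi / 2 * sqrt (\<Sum>i\<in>I. (x $ i)\<^sup>2)"
proof -
  define \<rho> where "\<rho> = sqrt (\<Sum>i\<in>I. (x $ i)\<^sup>2)"
  define \<tau> where "\<tau> = sqrt (\<Sum>i\<in>-I. (x $ i)\<^sup>2)"
  obtain u where u: "norm u = 1" "\<And>i. i \<notin> I \<Longrightarrow> u $ i = 0"
    "(\<chi> i. if i \<in> I then x $ i else 0) = \<rho> *\<^sub>R u"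
    by (rule unit_vector_of_coordinates[OF I(1), of x, folded \<rho>_def]) (rule that)
  have I': "- I \<noteq> {}" using I(2) by auto
  obtain v where v: "norm v = 1" "\<And>i. i \<notin> - I \<Longrightarrow> v $ i = 0"
    "(\<chi> i. if i \<in> - I then x $ i else 0) = \<tau> *\<^sub>R v"
    by (rule unit_vector_of_coordinates[OF I', of x, folded \<tau>_def]) (rule that)
  have "(\<Sum>i\<in>I. (x $ i)\<^sup>2) + (\<Sum>i\<in>-I. (x $ i)\<^sup>2) = (\<Sum>i\<in>UNIV. (x $ i)\<^sup>2)"
    by (subst sum.union_disjoint[symmetric]) (auto simp: Compl_partition)
  also have "\<dots> = 1"
    using x by (simp add: norm_eq_1 inner_vec_def power2_eq_square)
  finally have "\<rho>\<^sup>2 + \<tau>\<^sup>2 = 1"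
    by (simp add: \<rho>_def \<tau>_def sum_nonneg)
  moreover have \<rho>0: "\<rho> \<ge> 0" and "\<tau> \<ge> 0"
    by (simp_all add: \<rho>_def \<tau>_def sum_nonneg)
  ultimately have \<tau>: "\<tau> = sqrt (1 - \<rho>\<^sup>2)"
    by (intro real_sqrt_unique[symmetric]) auto
  have "\<rho>\<^sup>2 \<le> 1\<^sup>2"
    using \<open>\<rho>\<^sup>2 + \<tau>\<^sup>2 = 1\<close> zero_le_power2[of \<tau>] unfolding one_power2 by linarith
  then have \<rho>1: "\<rho> \<le> 1"
    by (rule_tac power2_le_imp_le) auto
  have "u \<bullet> v = 0"
    unfolding inner_vec_def using u(2) v(2) by (intro sum.neutral) auto
  then have "riemannian_dist (sphere 0 1) (sin (arcsin \<rho>) *\<^sub>R u + cos (arcsin \<rho>) *\<^sub>R v) v \<le> arcsin \<rho>"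
    using u(1) v(1) \<rho>0 \<rho>1 arcsin_le_arcsin[of 0 \<rho>] by (intro riemannian_dist_sphere_le_angle) auto
  also have "sin (arcsin \<rho>) *\<^sub>R u + cos (arcsin \<rho>) *\<^sub>R v = x"
    using \<rho>0 \<rho>1 by (simp add: cos_arcsin \<tau>[symmetric] u(3)[symmetric] v(3)[symmetric] vec_eq_iff)
  also have "arcsin \<rho> \<le> pi / 2 * \<rho>"
    using \<rho>0 \<rho>1 by (rule arcsin_le_half_pi_mult)
  finally show ?thesis
    using that[of v] v(1,2) by (simp add: \<rho>_def)
qed


section \<open>The tail bound\<close>

text \<open>The normalized volume of any set is 0 when the total volume \<open>K\<close> is 0 or infinite, as then
  \<open>inverse K * K = 0\<close> in the extended nonnegative reals. So \<open>inverse K * K \<le> 1\<close> replaces a proof that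
  the sphere has positive finite volume.\<close>

lemma measure_sphere_minus_open_nbhd_le:
  fixes I :: "'N::finite set" and r :: real
  assumes dim: "CARD('N) = CARD('k::{finite,wellorder}) + 1"
    and I: "I \<noteq> {}" "I \<noteq> UNIV" and r: "r > 0"
  defines "Sn \<equiv> sphere (0 :: real^'N) 1"
  shows "measure (normalized_riemannian_volume TYPE('k) Sn)
           (Sn - open_nbhd Sn {x \<in> Sn. \<forall>i\<in>I. x $ i = 0} r)
         \<le> sqrt 2 * exp (- (real CARD('N) * r\<^sup>2 / (pi\<^sup>2 * card I)))"
proof -
  define M where "M = riemannian_volume TYPE('k) Sn"
  define A where "A = {x \<in> Sn. \<forall>i\<in>I. x $ i = 0}"
  define D where "D = {x \<in> Sn. (2 * r / pi)\<^sup>2 \<le> (\<Sum>i\<in>I. (x $ i)\<^sup>2)}"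
  let ?C = "sqrt 2 * exp (- (real CARD('N) * r\<^sup>2 / (pi\<^sup>2 * card I)))"
  let ?\<nu> = "normalized_riemannian_volume TYPE('k) Sn"
  note bound = emeasure_coordinates_square_ge_le[OF dim I(1), of "(2 * r / pi)\<^sup>2",
      folded Sn_def, folded M_def, folded D_def]
  have sub: "Sn - open_nbhd Sn A r \<subseteq> D"
  proof
    fix x assume x: "x \<in> Sn - open_nbhd Sn A r"
    then have "norm x = 1"
      by (simp add: Sn_def)
    then obtain a where a: "norm a = 1" "\<forall>i\<in>I. a $ i = 0"
      "riemannian_dist Sn x a \<le> pi / 2 * sqrt (\<Sum>i\<in>I. (x $ i)\<^sup>2)"
      unfolding Sn_def using I by (rule riemannian_dist_subsphere_le) (blast intro: that)
    then have "a \<in> A"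
      by (simp add: A_def Sn_def)
    have "r \<le> riemannian_dist Sn x a"
      using x \<open>a \<in> A\<close> by (auto simp: open_nbhd_def not_less)
    also note a(3)
    finally have "2 * r / pi \<le> sqrt (\<Sum>i\<in>I. (x $ i)\<^sup>2)"
      by (simp add: field_simps)
    then have "(2 * r / pi)\<^sup>2 \<le> (sqrt (\<Sum>i\<in>I. (x $ i)\<^sup>2))\<^sup>2"
      using r by (intro power_mono) auto
    then show "x \<in> D"
      using x by (simp add: D_def sum_nonneg)
  qed
  have le1: "inverse K * K \<le> 1" for K :: ennreal
    by (cases "K = 0 \<or> K = top")
       (auto simp: top.not_eq_extremum mult.commute[of "inverse K"]
          ennreal_divide_self[unfolded divide_ennreal_def])
  have "emeasure ?\<nu> (Sn - open_nbhd Sn A r) \<le> emeasure ?\<nu> D"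
    using bound(1) by (intro emeasure_mono sub) (simp add: normalized_riemannian_volume_def M_def)
  also have "\<dots> = inverse (emeasure M Sn) * emeasure M D"
    by (simp add: normalized_riemannian_volume_def M_def)
  also have "\<dots> \<le> inverse (emeasure M Sn) * (ennreal ?C * emeasure M Sn)"
    using bound(2) by (intro mult_left_mono) (simp_all add: power_mult_distrib power_divide)
  also have "\<dots> = ennreal ?C * (inverse (emeasure M Sn) * emeasure M Sn)"
    by (simp add: mult_ac)
  also have "\<dots> \<le> ennreal ?C * 1"
    by (intro mult_left_mono le1) simp
  finally show ?thesis
    unfolding measure_def A_def[symmetric] by (intro enn2real_leI) simp_all
qed

lemma sqrt_2_less: "sqrt 2 < 3 / 2"
  by (rule real_less_lsqrt) (simp_all add: power2_eq_square)

text \<open>Completing the square costs a factor \<open>exp (1/18)\<close>, and \<open>sqrt 2 * exp (1/18) \<le> 2\<close>.\<close>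

lemma gaussian_le_exponential:
  fixes w :: real
  shows "sqrt 2 * exp (- w\<^sup>2) \<le> 2 * exp (- (sqrt 2 / 3 * w))"
proof -
  have "sqrt 2 / 3 * w - w\<^sup>2 = 1 / 18 - (w - sqrt 2 / 6)\<^sup>2"
    by (simp add: power2_diff power_divide)
  then have "- w\<^sup>2 \<le> 1 / 18 + - (sqrt 2 / 3 * w)"
    using zero_le_power2[of "w - sqrt 2 / 6"] by linarith
  then have "exp (- w\<^sup>2) \<le> exp (1 / 18) * exp (- (sqrt 2 / 3 * w))"
    unfolding exp_add[symmetric] by simp
  moreover have "exp (1 / 18) \<le> (18 / 17 :: real)"
  proof -
    have "17 / 18 \<le> exp (- (1 / 18) :: real)"
      using exp_ge_add_one_self[of "- (1 / 18) :: real"] by simp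
    then show ?thesis
      by (simp add: exp_minus field_simps)
  qed
  ultimately have "exp (- w\<^sup>2) \<le> 18 / 17 * exp (- (sqrt 2 / 3 * w))"
    by (meson exp_ge_zero mult_right_mono order_trans)
  then have "sqrt 2 * exp (- w\<^sup>2) \<le> 3 / 2 * (18 / 17 * exp (- (sqrt 2 / 3 * w)))"
    using sqrt_2_less by (intro mult_mono) auto
  also have "\<dots> \<le> 2 * exp (- (sqrt 2 / 3 * w))"
    by simp
  finally show ?thesis .
qed

lemma constants_ge_2:
  assumes "1 \<le> m"
  shows "const_A m \<ge> 2" "const_A' m \<ge> 2" "const_B m \<ge> 2" "const_B' m \<ge> 2"
proof -
  have m: "real m \<ge> 1"
    using assms by simp
  have p: "sqrt pi \<ge> 1"
    using pi_gt3 by simp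
  have e: "exp ((9 * real m - 3) / (4 * real m - 2)) \<ge> 1" "exp ((real m + 1) / (4 * real m - 2)) \<ge> 1"
    "exp (pi\<^sup>2 + (real m + 1) / (4 * real m - 2)) \<ge> 1" "exp (1 / (4 * real m - 2)) \<ge> 1"
    using m by (auto intro!: add_nonneg_nonneg divide_nonneg_nonneg)
  have prod: "1 \<le> x * y" if "1 \<le> x" "1 \<le> y" for x y :: real
    using mult_mono[OF that] that by simp
  have *: "2 \<le> 1 + sqrt pi * x / 2 * (2 + y)" if "x \<ge> 1" "y \<ge> 1" for x y
    using prod[OF prod[OF p that(1)], of "(2 + y) / 2"] that(2) by simp
  show "const_A m \<ge> 2" "const_A' m \<ge> 2"
    unfolding const_A_def const_A'_def by (intro * e)+
  show "const_B m \<ge> 2" "const_B' m \<ge> 2"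
    unfolding const_B_def const_B'_def using prod[OF p] e by simp_all
qed

theorem corollary4p1:
  fixes m n :: nat and r :: real and I :: "'N::finite set"
  assumes n: "CARD('k::{finite,wellorder}) = n" "CARD('N) = n + 1"
    and m: "1 \<le> m" "m \<le> n"
    and I: "card I = m"
    and r: "r > 0"
  defines "Sn \<equiv> sphere (0 :: real^'N) 1"
  shows "measure (normalized_riemannian_volume TYPE('k) Sn)
           (Sn - open_nbhd Sn {x \<in> Sn. \<forall>i\<in>I. x $ i = 0} r)
         \<le> Min {const_A m * exp (- (1 / (3 * pi)) * sqrt (2 * real n / real m) * r),
                 const_A' m * exp (- (1 / (3 * pi)) * sqrt (real n / (2 * real m)) * r),
                 const_B m * exp (- ((real n - 1) / (4 * pi\<^sup>2 * real m)) * r\<^sup>2),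
                 const_B' m * exp (- ((real n - 1) / (8 * pi\<^sup>2 * real m)) * r\<^sup>2)}"
proof -
  let ?P = "sqrt 2 * exp (- ((real n + 1) * r\<^sup>2 / (pi\<^sup>2 * m)))"
  have mn: "real m \<ge> 1" "real n \<ge> 1"
    using m by simp_all
  have "I \<noteq> {}" "I \<noteq> UNIV"
    using I m n by auto
  with measure_sphere_minus_open_nbhd_le[where 'k='k, of I r] n I r
  have P: "measure (normalized_riemannian_volume TYPE('k) Sn)
      (Sn - open_nbhd Sn {x \<in> Sn. \<forall>i\<in>I. x $ i = 0} r) \<le> ?P"
    by (simp add: Sn_def add.commute)
  have gauss: "?P \<le> c * exp (- ((real n - 1) / (d * pi\<^sup>2 * real m)) * r\<^sup>2)"
    if "c \<ge> 2" "d \<ge> 1" for c d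
  proof (rule mult_mono)
    have "(real n - 1) / (d * pi\<^sup>2 * real m) \<le> (real n + 1) / (pi\<^sup>2 * real m)"
      using that mn by (intro frac_le) auto
    from mult_right_mono[OF this, of "r\<^sup>2"]
    show "exp (- ((real n + 1) * r\<^sup>2 / (pi\<^sup>2 * m)))
        \<le> exp (- ((real n - 1) / (d * pi\<^sup>2 * real m)) * r\<^sup>2)"
      by simp
  qed (use that sqrt_2_less in auto)
  have expo: "?P \<le> c * exp (- (1 / (3 * pi)) * s * r)"
    if "c \<ge> 2" "s \<le> sqrt (2 * real n / real m)" for c s
  proof -
    \<comment> \<open>In terms of \<open>w\<close>, the Gaussian exponent is at least \<open>w\<^sup>2\<close> and the rate of the first exponential
      bound is exactly \<open>sqrt 2 / 3\<close>.\<close>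
    define w where "w = sqrt (real n / real m) * r / pi"
    have "w\<^sup>2 = real n * r\<^sup>2 / (pi\<^sup>2 * real m)"
      using mn by (simp add: w_def power_mult_distrib power_divide)
    also have "\<dots> \<le> (real n + 1) * r\<^sup>2 / (pi\<^sup>2 * m)"
      by (intro divide_right_mono mult_right_mono) auto
    finally have "?P \<le> sqrt 2 * exp (- w\<^sup>2)"
      by simp
    also have "\<dots> \<le> 2 * exp (- (sqrt 2 / 3 * w))"
      by (rule gaussian_le_exponential)
    also have "sqrt 2 / 3 * w = 1 / (3 * pi) * sqrt (2 * real n / real m) * r"
      by (simp add: w_def real_sqrt_mult real_sqrt_divide mult_ac)
    also have "2 * exp (- (1 / (3 * pi) * sqrt (2 * real n / real m) * r))
        \<le> c * exp (- (1 / (3 * pi) * s * r))"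
      using that r by (intro mult_mono) (auto intro!: mult_right_mono divide_right_mono)
    finally show ?thesis
      by simp
  qed
  have "real n / (2 * real m) \<le> 2 * real n / real m"
    using mn by (simp add: field_simps)
  then have half: "sqrt (real n / (2 * real m)) \<le> sqrt (2 * real n / real m)"
    by simp
  note c = constants_ge_2[OF m(1)]
  have "?P \<le> const_A m * exp (- (1 / (3 * pi)) * sqrt (2 * real n / real m) * r)"
    "?P \<le> const_A' m * exp (- (1 / (3 * pi)) * sqrt (real n / (2 * real m)) * r)"
    "?P \<le> const_B m * exp (- ((real n - 1) / (4 * pi\<^sup>2 * real m)) * r\<^sup>2)"
    "?P \<le> const_B' m * exp (- ((real n - 1) / (8 * pi\<^sup>2 * real m)) * r\<^sup>2)"
    using expo[OF c(1) order_refl] expo[OF c(2) half] gauss[OF c(3), of 4] gauss[OF c(4), of 8]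
    by simp_all
  with P show ?thesis
    by simp
qed

end
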